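(* Let $\sigma>0$ and let $\mu$ be a real function of bounded variation on the segment $[0,\sigma]$. Put $$F(z):=\int_0^\sigma e^{izt}\,d\mu(t),\qquad S(z):=-\int_0^\sigma\sin(zt)\,d\mu(\sigma-t).$$ Suppose that $S(x)\ge0$ for all $x>0$ and $F(z)\not\equiv0$. Then all real zeros of $F$ distinct from $0$, if there are any, are simple, and if $x=0$ is a zero of $F$, then its multiplicity does not exceed $2$. Moreover, $\mu(\sigma-0)\ge\mu(0)$ and the following holds. 1) If $F(0)\in(-\infty,0]\cup[\mu(\sigma-0)-\mu(0),+\infty)$, then $F\in\overline{HB}$ and $F$ is not trivial. 2) If $F(0)\in(0,\mu(\sigma-0)-\mu(0))$, then $F$ has exactly one zero in the lower half-plane $\operatorname{Im}z<0$, and it is purely imaginary.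
   Context: Integrals are Stieltjes integrals over $[0,\sigma]$ (jumps of $\mu$ at the end points are counted, so $F(0)=\mu(\sigma)-\mu(0)$). $\mu(\sigma-0)$ denotes the left limit of $\mu$ at $\sigma$. For an entire function $\omega=P+iQ$ with $P,Q$ entire and real-valued on $\mathbb{R}$, $\overline{\omega}(z):=P(z)-iQ(z)=\overline{\omega(\overline z)}$. $\overline{HB}$ is the class of entire functions $\omega$ that have no zeros in the open lower half-plane $\operatorname{Im}z<0$ and satisfy $\bigl|\omega(z)/\overline{\omega}(z)\bigr|\le1$ for $\operatorname{Im}z>0$. A function in $\overline{HB}$ is called trivial if it is real up to a constant factor, i.e. equals a complex constant times an entire function that is real on the real axis. *)

theory Defs
  imports "HOL-Complex_Analysis.Complex_Analysis"
begin

definition bounded_variation_on :: "(real \<Rightarrow> real) \<Rightarrow> real \<Rightarrow> real \<Rightarrow> bool" where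
  "bounded_variation_on g a b \<longleftrightarrow>
     (\<exists>B. \<forall>d. d division_of {a..b} \<longrightarrow> (\<Sum>K\<in>d. \<bar>g (Sup K) - g (Inf K)\<bar>) \<le> B)"

text \<open>
  The Riemann--Stieltjes integral of \<open>f\<close> with respect to \<open>g\<close> over the closed interval from
  \<open>a\<close> to \<open>b\<close>, as the limit of the tagged sums when the mesh tends to zero. The increments use the
  values of \<open>g\<close> at \<open>a\<close> and \<open>b\<close> themselves, so jumps at the end points are counted.
\<close>

definition has_stieltjes_integral ::
    "(real \<Rightarrow> 'a::real_normed_vector) \<Rightarrow> (real \<Rightarrow> real) \<Rightarrow> 'a \<Rightarrow> real \<Rightarrow> real \<Rightarrow> bool" where
  "has_stieltjes_integral f g I a b \<longleftrightarrow>
     (\<forall>e>0. \<exists>d>0. \<forall>p. p tagged_division_of {a..b} \<and> (\<forall>(x,K)\<in>p. Sup K - Inf K < d) \<longrightarrow>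
        norm ((\<Sum>(x,K)\<in>p. (g (Sup K) - g (Inf K)) *\<^sub>R f x) - I) < e)"

definition stieltjes_integral ::
    "real \<Rightarrow> real \<Rightarrow> (real \<Rightarrow> 'a::real_normed_vector) \<Rightarrow> (real \<Rightarrow> real) \<Rightarrow> 'a" where
  "stieltjes_integral a b f g = (THE I. has_stieltjes_integral f g I a b)"

lemma has_stieltjes_integral_unique:
  fixes f :: "real \<Rightarrow> 'a::real_normed_vector"
  assumes I: "has_stieltjes_integral f g I a b" and J: "has_stieltjes_integral f g J a b"
  shows "I = J"
proof (rule ccontr)
  assume "I \<noteq> J"
  define e where "e = norm (I - J) / 2"
  have e: "e > 0" using \<open>I \<noteq> J\<close> by (simp add: e_def)
  obtain d1 where d1: "d1 > 0" and
    D1: "\<And>p. \<lbrakk>p tagged_division_of {a..b}; \<forall>(x,K)\<in>p. Sup K - Inf K < d1\<rbrakk> \<Longrightarrow>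
        norm ((\<Sum>(x,K)\<in>p. (g (Sup K) - g (Inf K)) *\<^sub>R f x) - I) < e"
    using I e unfolding has_stieltjes_integral_def by meson
  obtain d2 where d2: "d2 > 0" and
    D2: "\<And>p. \<lbrakk>p tagged_division_of {a..b}; \<forall>(x,K)\<in>p. Sup K - Inf K < d2\<rbrakk> \<Longrightarrow>
        norm ((\<Sum>(x,K)\<in>p. (g (Sup K) - g (Inf K)) *\<^sub>R f x) - J) < e"
    using J e unfolding has_stieltjes_integral_def by meson
  define d where "d = min d1 d2 / 2"
  have "gauge (\<lambda>x. ball x d)" using d1 d2 by (simp add: d_def gauge_ball)
  then obtain p where p: "p tagged_division_of cbox a b" "(\<lambda>x. ball x d) fine p"
    using fine_division_exists by blast
  have len: "Sup K - Inf K < min d1 d2" if xK: "(x,K) \<in> p" for x K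
  proof -
    obtain u v where K: "K = cbox u v" using p(1) xK by blast
    moreover have "x \<in> K" using p(1) xK by blast
    ultimately have uv: "u \<le> v" by auto
    have "K \<subseteq> ball x d" using p(2) xK by (auto simp: fine_def)
    hence "u \<in> ball x d" "v \<in> ball x d" using uv K by auto
    hence "v - u < 2 * d" by (auto simp: dist_real_def)
    thus ?thesis using uv K by (simp add: d_def)
  qed
  let ?s = "\<Sum>(x,K)\<in>p. (g (Sup K) - g (Inf K)) *\<^sub>R f x"
  have "norm (?s - I) < e" using D1[of p] p(1) len by fastforce
  moreover have "norm (?s - J) < e" using D2[of p] p(1) len by fastforce
  moreover have "norm (I - J) \<le> norm (?s - I) + norm (?s - J)"
    using norm_triangle_ineq4[of "?s - J" "?s - I"] by simp
  ultimately show False by (simp add: e_def)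
qed

lemma stieltjes_integral_eqI:
  "has_stieltjes_integral f g I a b \<Longrightarrow> stieltjes_integral a b f g = I"
  unfolding stieltjes_integral_def
  by (rule the_equality) (auto intro: has_stieltjes_integral_unique)

text \<open>For \<open>\<omega> = P + iQ\<close> with \<open>P\<close>, \<open>Q\<close> entire and real on the real axis this is \<open>P - iQ\<close>.\<close>

definition conj_fun :: "(complex \<Rightarrow> complex) \<Rightarrow> complex \<Rightarrow> complex" where
  "conj_fun \<omega> z = cnj (\<omega> (cnj z))"

definition HB_bar :: "(complex \<Rightarrow> complex) set" where
  "HB_bar = {\<omega>. \<omega> holomorphic_on UNIV \<and> (\<forall>z. Im z < 0 \<longrightarrow> \<omega> z \<noteq> 0) \<and>
     (\<forall>z. Im z > 0 \<longrightarrow> norm (\<omega> z / conj_fun \<omega> z) \<le> 1)}"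

definition trivial_HB :: "(complex \<Rightarrow> complex) \<Rightarrow> bool" where
  "trivial_HB \<omega> \<longleftrightarrow>
     (\<exists>c h. h holomorphic_on UNIV \<and> (\<forall>x::real. h (of_real x) \<in> \<real>) \<and> \<omega> = (\<lambda>z. c * h z))"

end

theory Submission
  imports Defs
begin

text \<open>
  Put \<open>K z = exp (\<i> \<sigma> z) F(-z)\<close>, that is, the Stieltjes integral of \<open>exp (\<i> z (\<sigma> - t))\<close> with respect to \<open>\<mu>\<close>. This
  entire function is bounded in the upper half-plane, satisfies \<open>K (- cnj z) = cnj (K z)\<close>, and \<open>Im K = S\<close> on
  the real axis. Applying the Phragmen-Lindelof principle to \<open>exp (\<i> K)\<close> in the first quadrant turns the
  hypothesis \<open>S x \<ge> 0\<close> into \<open>Im K \<ge> 0\<close> in the whole quadrant (\<open>Im_nonneg\<close>). By symmetry \<open>Im K \<le> 0\<close> in the second quadrant,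
  and \<open>K\<close> is real on the imaginary axis. Everything follows from this pattern of signs.

  Near a zero of order \<open>n\<close> the imaginary part changes sign between consecutive sectors of opening \<open>pi / n\<close>.
  So a half-disc of constant sign forces \<open>n \<le> 1\<close>, a quarter-disc \<open>n \<le> 2\<close>, and a full disc excludes a zero
  (\<open>zorder_sector_bound\<close>). These three cases are the real zeros other than \<open>0\<close>, the zero at \<open>0\<close>, and the
  points of the upper half-plane off the imaginary axis.

  On the imaginary axis \<open>h y = K (\<i> y)\<close> is real, nonincreasing for \<open>y \<ge> 0\<close>, and strictly decreasing unless \<open>K\<close> is
  constant: the sign pattern fixes the sign of the normal derivative of \<open>Im K\<close>, and this derivative does not
  vanish because \<open>K\<close> takes each value on the axis to order one, again by the half-disc case. It starts at
  \<open>h 0 = F 0 = \<mu> \<sigma> - \<mu> 0\<close> and tends to the jump \<open>\<mu> \<sigma> - m = F 0 - (m - \<mu> 0)\<close>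
  (\<open>fourier_stieltjes_reflected_limit\<close>). Hence \<open>m \<ge> \<mu> 0\<close>, and \<open>h\<close> has a zero \<open>y > 0\<close>, then a single and simple one,
  if and only if \<open>0 < F 0 < m - \<mu> 0\<close>.

  If there is no such zero, \<open>h\<close> has constant sign, and \<open>K\<close> or \<open>- K\<close> maps the upper half-plane to the plane slit
  along the nonpositive real axis. It then is the square of a function with positive real part, hence outer:
  every entire function that is bounded in the upper half-plane and dominated by \<open>K\<close> on the real axis is dominated by
  \<open>K\<close> in the half-plane (\<open>slit_plane_majorant\<close>). Applied to \<open>F\<close> itself, whose modulus on the real axis is
  that of \<open>K\<close>, this gives
  \<open>norm (F z) \<le> norm (K z) = exp (- \<sigma> Im z) norm (conj_fun F z)\<close> for \<open>Im z \<ge> 0\<close>, so \<open>F\<close> lies in \<open>HB_bar\<close>. The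
  factor \<open>exp (- \<sigma> Im z)\<close> is less than \<open>1\<close>, whereas the two moduli would be equal if \<open>F\<close> were trivial.
\<close>

section \<open>Functions of bounded variation\<close>

text \<open>The model is the variation function of \<open>g\<close> from \<open>a\<close>. The increments of \<open>V\<close> add up over a division, and so
  they control both the oscillations of \<open>g\<close> and its Stieltjes sums.\<close>

definition variation_majorant :: "(real \<Rightarrow> real) \<Rightarrow> (real \<Rightarrow> real) \<Rightarrow> real \<Rightarrow> real \<Rightarrow> bool" where
  "variation_majorant V g a b \<longleftrightarrow> (\<forall>s t. a \<le> s \<longrightarrow> s \<le> t \<longrightarrow> t \<le> b \<longrightarrow> \<bar>g t - g s\<bar> \<le> V t - V s)"

lemma variation_majorantD:
  "variation_majorant V g a b \<Longrightarrow> a \<le> s \<Longrightarrow> s \<le> t \<Longrightarrow> t \<le> b \<Longrightarrow> \<bar>g t - g s\<bar> \<le> V t - V s"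
  by (auto simp: variation_majorant_def)

lemma variation_majorant_mono:
  assumes "variation_majorant V g a b"
  shows "mono_on {a..b} V" "mono_on {a..b} (\<lambda>t. V t - g t)"
  using variation_majorantD[OF assms] by (fastforce intro!: mono_onI)+

text \<open>\<open>V t\<close> is the supremum of the variation sums over \<open>[a, t]\<close>. Appending the single interval \<open>[s, t]\<close> to a
  division of \<open>[a, s]\<close> gives a division of \<open>[a, t]\<close>, whence \<open>V s + \<bar>g t - g s\<bar> \<le> V t\<close>.\<close>

lemma variation_majorant_exists:
  assumes "bounded_variation_on g a b"
  obtains V where "variation_majorant V g a b"
proof -
  define A where "A t = {\<Sum>K\<in>d. \<bar>g (Sup K) - g (Inf K)\<bar> | d. d division_of {a..t}}" for t
  define V where "V t = Sup (A t)" for t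
  obtain B where B: "d division_of {a..b} \<Longrightarrow> (\<Sum>K\<in>d. \<bar>g (Sup K) - g (Inf K)\<bar>) \<le> B" for d
    using assms unfolding bounded_variation_on_def by blast
  have step: "\<exists>y\<in>A t. x + \<bar>g t - g s\<bar> \<le> y" if x: "x \<in> A s" and st: "a \<le> s" "s \<le> t" for x s t
  proof (cases "s = t")
    case True thus ?thesis using x by auto
  next
    case False
    hence "s < t" using st by simp
    obtain d where d: "d division_of {a..s}" and xd: "x = (\<Sum>K\<in>d. \<bar>g (Sup K) - g (Inf K)\<bar>)"
      using x unfolding A_def by blast
    have st1: "{{s..t}} division_of {s..t}"
      using division_of_self[of s t] \<open>s < t\<close> by simp
    have "d \<union> {{s..t}} division_of {a..s} \<union> {s..t}"
      using d st1 by (rule division_disjoint_union) auto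
    moreover have "{a..s} \<union> {s..t} = {a..t}" using st by auto
    ultimately have D: "insert {s..t} d division_of {a..t}" by simp
    have "{s..t} \<notin> d"
    proof
      assume "{s..t} \<in> d"
      hence "{s..t} \<subseteq> {a..s}" using d by auto
      thus False using \<open>s < t\<close> by auto
    qed
    moreover have "finite d" using d by auto
    ultimately have "(\<Sum>K\<in>insert {s..t} d. \<bar>g (Sup K) - g (Inf K)\<bar>) = x + \<bar>g t - g s\<bar>"
      using \<open>s < t\<close> by (simp add: xd)
    thus ?thesis using D unfolding A_def by (intro bexI[of _ "x + \<bar>g t - g s\<bar>"]) force+
  qed
  have ne: "A t \<noteq> {}" if "a \<le> t" for t
    using division_of_self[of a t] that unfolding A_def by auto
  have bdd: "bdd_above (A t)" if at: "a \<le> t" "t \<le> b" for t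
  proof (rule bdd_aboveI)
    fix x assume "x \<in> A t"
    then obtain y where "y \<in> A b" "x + \<bar>g b - g t\<bar> \<le> y"
      using step[of x t b] at by blast
    moreover have "y \<le> B" using \<open>y \<in> A b\<close> B unfolding A_def by auto
    ultimately show "x \<le> B" by linarith
  qed
  have "\<bar>g t - g s\<bar> \<le> V t - V s" if st: "a \<le> s" "s \<le> t" "t \<le> b" for s t
  proof -
    have "V s \<le> V t - \<bar>g t - g s\<bar>" unfolding V_def[of s]
    proof (rule cSup_least)
      show "A s \<noteq> {}" using ne st by simp
      fix x assume "x \<in> A s"
      then obtain y where y: "y \<in> A t" "x + \<bar>g t - g s\<bar> \<le> y" using step[of x s t] st by blast
      have "y \<le> V t" unfolding V_def using y(1) bdd st by (intro cSup_upper) auto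
      thus "x \<le> V t - \<bar>g t - g s\<bar>" using y by simp
    qed
    thus ?thesis by simp
  qed
  thus ?thesis using that unfolding variation_majorant_def by blast
qed

lemma mono_on_left_limit_exists:
  fixes h :: "real \<Rightarrow> real"
  assumes "a < b" "mono_on {a..b} h"
  shows "\<exists>l. (h \<longlongrightarrow> l) (at_left b)"
proof
  let ?l = "SUP t\<in>{a..<b}. h t"
  have bdd: "bdd_above (h ` {a..<b})"
    using assms by (intro bdd_aboveI[of _ "h b"]) (auto intro: mono_onD[OF assms(2)])
  show "(h \<longlongrightarrow> ?l) (at_left b)"
  proof (rule increasing_tendsto)
    have ev: "\<forall>\<^sub>F t in at_left b. t \<in> {a<..<b}"
      using eventually_at_left_real[OF assms(1)] .
    show "\<forall>\<^sub>F t in at_left b. h t \<le> ?l"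
      using ev by eventually_elim (auto intro!: cSUP_upper bdd)
    fix x assume "x < ?l"
    then obtain s where s: "s \<in> {a..<b}" "x < h s"
      using less_cSUP_iff[OF _ bdd, of x] assms(1) by auto
    have "\<forall>\<^sub>F t in at_left b. t \<in> {s<..<b}"
      using s by (intro eventually_at_left_real) auto
    thus "\<forall>\<^sub>F t in at_left b. x < h t"
    proof eventually_elim
      case (elim t)
      have "h s \<le> h t" using elim s by (auto intro: mono_onD[OF assms(2)])
      thus ?case using s by simp
    qed
  qed
qed

text \<open>\<open>g = V - (V - g)\<close> is a difference of two nondecreasing functions.\<close>

lemma variation_majorant_left_limit:
  assumes "a < b" "variation_majorant V g a b"
  shows "(g \<longlongrightarrow> Lim (at_left b) g) (at_left b)"
proof -
  obtain l1 l2 where "(V \<longlongrightarrow> l1) (at_left b)" "((\<lambda>t. V t - g t) \<longlongrightarrow> l2) (at_left b)"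
    using mono_on_left_limit_exists[OF assms(1)] variation_majorant_mono[OF assms(2)] by blast
  from tendsto_diff[OF this] have "(g \<longlongrightarrow> l1 - l2) (at_left b)" by simp
  moreover from this have "Lim (at_left b) g = l1 - l2"
    by (intro tendsto_Lim) (auto simp: trivial_limit_at_left_real)
  ultimately show ?thesis by simp
qed

lemma variation_majorant_continuous_product_integrable:
  fixes f' :: "real \<Rightarrow> complex"
  assumes V: "variation_majorant V g a b" and f': "continuous_on {a..b} f'"
  shows "(\<lambda>t. g t *\<^sub>R f' t) integrable_on {a..b}"
proof -
  have i: "integrable (lebesgue_on {a..b}) (\<lambda>t. V t - (V t - g t))"
    using variation_majorant_mono[OF V]
    by (intro Bochner_Integration.integrable_diff integrable_mono_on)
  hence g: "g absolutely_integrable_on {a..b}"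
    by (simp add: absolutely_integrable_on_def set_integrable_def integrable_restrict_space)
  have "(\<lambda>t. f' t * complex_of_real (g t)) absolutely_integrable_on {a..b}"
  proof (rule absolutely_integrable_bounded_measurable_product[where h="\<lambda>x y. x * y"])
    show "bilinear (\<lambda>x y::complex. x * y)" by (simp add: bilinear_times)
    show "f' \<in> borel_measurable (lebesgue_on {a..b})"
      using f' by (intro continuous_imp_measurable_on_sets_lebesgue) auto
    show "bounded (f' ` {a..b})"
      using compact_continuous_image[OF f'] by (simp add: compact_imp_bounded)
    show "(\<lambda>t. complex_of_real (g t)) absolutely_integrable_on {a..b}"
      using absolutely_integrable_linear[OF g bounded_linear_of_real] by (simp add: o_def)
  qed auto
  from absolutely_integrable_on_def[THEN iffD1, OF this] have "(\<lambda>t. f' t * complex_of_real (g t)) integrable_on {a..b}"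
    by blast
  thus ?thesis by (simp add: scaleR_conv_of_real mult.commute)
qed

section \<open>Stieltjes integrals of smooth functions\<close>

text \<open>Integration by parts on one interval \<open>[u, v]\<close> with tag \<open>x\<close> expresses the difference between the term of
  the sum and the by-parts value as
  \<open>\<integral>\<^sub>u\<^sup>x (g t - g u) f'(t) dt + \<integral>\<^sub>x\<^sup>v (g t - g v) f'(t) dt\<close>,
  which is at most \<open>(V v - V u) L (v - u)\<close>; these bounds telescope. The estimate is quantitative so that
  it gives both existence of the integral and convergence that is uniform in a parameter of \<open>f\<close>.\<close>

lemma stieltjes_sum_error:
  fixes f f' :: "real \<Rightarrow> complex"
  assumes ab: "a \<le> b" and V: "variation_majorant V g a b"
    and f: "\<And>t. t \<in> {a..b} \<Longrightarrow> (f has_vector_derivative f' t) (at t within {a..b})"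
    and f': "continuous_on {a..b} f'"
    and L: "\<And>t. t \<in> {a..b} \<Longrightarrow> norm (f' t) \<le> L"
    and p: "p tagged_division_of {a..b}" and mesh: "\<forall>(x,K)\<in>p. Sup K - Inf K \<le> d"
  shows "norm ((\<Sum>(x,K)\<in>p. (g (Sup K) - g (Inf K)) *\<^sub>R f x) -
     (g b *\<^sub>R f b - g a *\<^sub>R f a - integral {a..b} (\<lambda>t. g t *\<^sub>R f' t))) \<le> d * L * (V b - V a)"
proof -
  let ?h = "\<lambda>t. g t *\<^sub>R f' t"
  have L0: "L \<ge> 0" using L[of a] ab norm_ge_zero[of "f' a"] by (simp del: norm_ge_zero)
  have int: "?h integrable_on {u..v}" if "{u..v} \<subseteq> {a..b}" for u v
    using variation_majorant_continuous_product_integrable[OF V f'] that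
    by (rule integrable_subinterval_real)
  define T where "T K = g (Sup K) *\<^sub>R f (Sup K) - g (Inf K) *\<^sub>R f (Inf K) - integral K ?h" for K
  have total: "g b *\<^sub>R f b - g a *\<^sub>R f a - integral {a..b} ?h = (\<Sum>(x,K)\<in>p. T K)"
  proof -
    have "(\<Sum>(x,K)\<in>p. g (Sup K) *\<^sub>R f (Sup K) - g (Inf K) *\<^sub>R f (Inf K)) = g b *\<^sub>R f b - g a *\<^sub>R f a"
      using additive_tagged_division_1[OF ab p, of "\<lambda>t. g t *\<^sub>R f t"] .
    moreover have "integral {a..b} ?h = (\<Sum>(x,K)\<in>p. integral K ?h)"
      using integral_combine_tagged_division_topdown[of ?h a b p] int[of a b] p by simp
    ultimately show ?thesis
      by (simp add: T_def sum_subtractf split_def)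
  qed
  have piece: "norm ((g (Sup K) - g (Inf K)) *\<^sub>R f x - T K) \<le> d * L * (V (Sup K) - V (Inf K))"
    if xK: "(x,K) \<in> p" for x K
  proof -
    obtain u v where K: "K = cbox u v" using p xK by blast
    moreover have "x \<in> K" "K \<subseteq> {a..b}" using p xK by blast+
    ultimately have uv: "u \<le> x" "x \<le> v" "a \<le> u" "v \<le> b" "K = {u..v}" by auto
    have mesh_K: "v - u \<le> d" using mesh xK uv by force
    have ftc: "(f' has_integral (f t - f s)) {s..t}" if "a \<le> s" "s \<le> t" "t \<le> b" for s t
      using that by (intro fundamental_theorem_of_calculus)
        (auto intro!: has_vector_derivative_within_subset[OF f])
    have osc: "norm ((integral {s..t} ?h) - c *\<^sub>R (f t - f s)) \<le> (V v - V u) * L * (t - s)"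
      if st: "a \<le> s" "s \<le> t" "t \<le> b" and c: "\<And>r. r \<in> {s..t} \<Longrightarrow> \<bar>g r - c\<bar> \<le> V v - V u" for s t c
    proof -
      have "((\<lambda>r. g r *\<^sub>R f' r - c *\<^sub>R f' r) has_integral (integral {s..t} ?h - c *\<^sub>R (f t - f s))) {s..t}"
        using st by (intro has_integral_diff has_integral_cmul ftc integrable_integral int) auto
      hence hi: "((\<lambda>r. (g r - c) *\<^sub>R f' r) has_integral (integral {s..t} ?h - c *\<^sub>R (f t - f s))) (cbox s t)"
        by (simp add: scaleR_diff_left)
      have V0: "V v - V u \<ge> 0" using c[of s] st by auto
      have "norm (integral {s..t} ?h - c *\<^sub>R (f t - f s)) \<le> ((V v - V u) * L) * measure lborel (cbox s t)"
      proof (rule has_integral_bound[OF _ hi])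
        show "0 \<le> (V v - V u) * L" using V0 L0 by simp
        fix r assume "r \<in> cbox s t"
        thus "norm ((g r - c) *\<^sub>R f' r) \<le> (V v - V u) * L"
          using c[of r] L[of r] V0 st by (auto intro!: mult_mono)
      qed
      thus ?thesis using st by simp
    qed
    have Vm: "V s \<le> V t" if "a \<le> s" "s \<le> t" "t \<le> b" for s t
      using variation_majorantD[OF V that] by simp
    have o1: "norm (integral {u..x} ?h - g u *\<^sub>R (f x - f u)) \<le> (V v - V u) * L * (x - u)"
    proof (rule osc)
      fix r assume "r \<in> {u..x}"
      thus "\<bar>g r - g u\<bar> \<le> V v - V u"
        using variation_majorantD[OF V, of u r] Vm[of r v] uv by auto
    qed (use uv in auto)
    have o2: "norm (integral {x..v} ?h - g v *\<^sub>R (f v - f x)) \<le> (V v - V u) * L * (v - x)"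
    proof (rule osc)
      fix r assume "r \<in> {x..v}"
      thus "\<bar>g r - g v\<bar> \<le> V v - V u"
        using variation_majorantD[OF V, of r v] Vm[of u r] uv by auto
    qed (use uv in auto)
    have "integral K ?h = integral {u..x} ?h + integral {x..v} ?h"
      using uv int[of u v] Henstock_Kurzweil_Integration.integral_combine[of u x v ?h] by auto
    hence "(g (Sup K) - g (Inf K)) *\<^sub>R f x - T K =
        (integral {u..x} ?h - g u *\<^sub>R (f x - f u)) + (integral {x..v} ?h - g v *\<^sub>R (f v - f x))"
      using uv by (simp add: T_def algebra_simps)
    hence "norm ((g (Sup K) - g (Inf K)) *\<^sub>R f x - T K) \<le> (V v - V u) * L * (x - u) + (V v - V u) * L * (v - x)"
      using norm_triangle_mono[OF o1 o2] by simp
    also have "\<dots> = (V v - V u) * L * (v - u)" by (simp add: algebra_simps)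
    also have "\<dots> \<le> (V v - V u) * L * d"
      using mesh_K L0 Vm[of u v] uv by (intro mult_left_mono) auto
    finally show ?thesis using uv by (simp add: mult_ac)
  qed
  have "norm ((\<Sum>(x,K)\<in>p. (g (Sup K) - g (Inf K)) *\<^sub>R f x) - (\<Sum>(x,K)\<in>p. T K))
      = norm (\<Sum>(x,K)\<in>p. (g (Sup K) - g (Inf K)) *\<^sub>R f x - T K)"
    by (simp add: sum_subtractf split_def)
  also have "\<dots> \<le> (\<Sum>(x,K)\<in>p. d * L * (V (Sup K) - V (Inf K)))"
    using piece by (intro sum_norm_le) auto
  also have "\<dots> = d * L * (\<Sum>(x,K)\<in>p. V (Sup K) - V (Inf K))"
    by (simp add: sum_distrib_left split_def)
  also have "(\<Sum>(x,K)\<in>p. V (Sup K) - V (Inf K)) = V b - V a"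
    using additive_tagged_division_1[OF ab p, of V] .
  finally show ?thesis unfolding total .
qed

lemma has_stieltjes_integral_by_parts:
  fixes f f' :: "real \<Rightarrow> complex"
  assumes ab: "a \<le> b" and V: "variation_majorant V g a b"
    and f: "\<And>t. t \<in> {a..b} \<Longrightarrow> (f has_vector_derivative f' t) (at t within {a..b})"
    and f': "continuous_on {a..b} f'"
  shows "has_stieltjes_integral f g (g b *\<^sub>R f b - g a *\<^sub>R f a - integral {a..b} (\<lambda>t. g t *\<^sub>R f' t)) a b"
proof -
  have "bounded (f' ` {a..b})" using compact_continuous_image[OF f'] by (simp add: compact_imp_bounded)
  then obtain L where L: "L > 0" "\<And>t. t \<in> {a..b} \<Longrightarrow> norm (f' t) \<le> L"
    by (auto simp: bounded_pos)
  define C where "C = L * (V b - V a) + 1"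
  have V0: "V b - V a \<ge> 0" using variation_majorantD[OF V, of a b] ab by auto
  hence C: "C > 0" using L(1) by (auto simp: C_def intro!: add_nonneg_pos)
  show ?thesis unfolding has_stieltjes_integral_def
  proof (intro allI impI)
    fix e :: real assume e: "e > 0"
    have "norm ((\<Sum>(x,K)\<in>p. (g (Sup K) - g (Inf K)) *\<^sub>R f x) -
          (g b *\<^sub>R f b - g a *\<^sub>R f a - integral {a..b} (\<lambda>t. g t *\<^sub>R f' t))) < e"
      if p: "p tagged_division_of {a..b}" "\<forall>(x,K)\<in>p. Sup K - Inf K < e / C" for p
    proof -
      have "\<forall>(x,K)\<in>p. Sup K - Inf K \<le> e / C" using p(2) by fastforce
      from stieltjes_sum_error[OF ab V f f' L(2) p(1) this]
      have "norm ((\<Sum>(x,K)\<in>p. (g (Sup K) - g (Inf K)) *\<^sub>R f x) -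
          (g b *\<^sub>R f b - g a *\<^sub>R f a - integral {a..b} (\<lambda>t. g t *\<^sub>R f' t))) \<le> e / C * L * (V b - V a)"
        by simp
      also have "\<dots> < e / C * C"
        using e C by (simp only: C_def mult.assoc) (intro mult_strict_left_mono, auto)
      also have "e / C * C = e" using C by simp
      finally show ?thesis .
    qed
    moreover have "e / C > 0" using e C by simp
    ultimately show "\<exists>d>0. \<forall>p. p tagged_division_of {a..b} \<and> (\<forall>(x,K)\<in>p. Sup K - Inf K < d) \<longrightarrow>
        norm ((\<Sum>(x,K)\<in>p. (g (Sup K) - g (Inf K)) *\<^sub>R f x) -
          (g b *\<^sub>R f b - g a *\<^sub>R f a - integral {a..b} (\<lambda>t. g t *\<^sub>R f' t))) < e"
      by blast
  qed
qed

lemma fine_tagged_divisions: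
  fixes a b :: real
  shows "\<exists>P. \<forall>n::nat. P n tagged_division_of {a..b} \<and> (\<forall>(x,K)\<in>P n. Sup K - Inf K \<le> 1 / (real n + 1))"
proof -
  have "\<exists>p. p tagged_division_of {a..b} \<and> (\<forall>(x,K)\<in>p. Sup K - Inf K \<le> 1 / (real n + 1))" for n :: nat
  proof -
    define d where "d = 1 / (2 * (real n + 1))"
    have "gauge (\<lambda>x::real. ball x d)" by (simp add: d_def gauge_ball)
    then obtain p where p: "p tagged_division_of cbox a b" "(\<lambda>x. ball x d) fine p"
      using fine_division_exists by blast
    have "Sup K - Inf K \<le> 1 / (real n + 1)" if xK: "(x,K) \<in> p" for x K
    proof -
      obtain u v where K: "K = cbox u v" using p(1) xK by blast
      moreover have "x \<in> K" using p(1) xK by blast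
      ultimately have uv: "u \<le> v" by auto
      have "K \<subseteq> ball x d" using p(2) xK by (auto simp: fine_def)
      hence "u \<in> ball x d" "v \<in> ball x d" using uv K by auto
      hence "v - u < 2 * d" by (auto simp: dist_real_def)
      moreover have "2 * d = 1 / (real n + 1)" by (simp add: d_def divide_simps)
      ultimately show ?thesis using uv K by simp
    qed
    thus ?thesis using p(1) by (intro exI[of _ p]) auto
  qed
  thus ?thesis by (intro choice allI)
qed

lemma stieltjes_integral_norm_le:
  fixes f :: "real \<Rightarrow> complex"
  assumes ab: "a \<le> b" and V: "variation_majorant V g a b"
    and I: "has_stieltjes_integral f g I a b"
    and M: "\<And>t. t \<in> {a..b} \<Longrightarrow> norm (f t) \<le> M"
  shows "norm I \<le> M * (V b - V a)"
proof (rule field_le_epsilon)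
  fix e :: real assume "e > 0"
  then obtain d where d: "d > 0" "\<And>p. p tagged_division_of {a..b} \<Longrightarrow> (\<forall>(x,K)\<in>p. Sup K - Inf K < d) \<Longrightarrow>
        norm ((\<Sum>(x,K)\<in>p. (g (Sup K) - g (Inf K)) *\<^sub>R f x) - I) < e"
    using I unfolding has_stieltjes_integral_def by meson
  obtain n :: nat where n: "1 / (real n + 1) < d" 
    using reals_Archimedean[OF d(1)] by (auto simp: inverse_eq_divide add.commute)
  obtain P where "\<forall>n::nat. P n tagged_division_of {a..b} \<and> (\<forall>(x,K)\<in>P n. Sup K - Inf K \<le> 1 / (real n + 1))"
    using fine_tagged_divisions[of a b] ..
  hence P: "\<And>n. P n tagged_division_of {a..b}"
    "\<And>n::nat. \<forall>(x,K)\<in>P n. Sup K - Inf K \<le> 1 / (real n + 1)" by auto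
  let ?p = "P n"
  have "\<forall>(x,K)\<in>?p. Sup K - Inf K < d" using P(2)[of n] n by fastforce
  hence close: "norm ((\<Sum>(x,K)\<in>?p. (g (Sup K) - g (Inf K)) *\<^sub>R f x) - I) < e" using d(2) P(1) by blast
  have "norm (\<Sum>(x,K)\<in>?p. (g (Sup K) - g (Inf K)) *\<^sub>R f x) \<le> (\<Sum>(x,K)\<in>?p. M * (V (Sup K) - V (Inf K)))"
  proof (rule sum_norm_le, clarify)
    fix x K assume xK: "(x,K) \<in> ?p"
    obtain u v where K: "K = cbox u v" using P(1) xK by blast
    moreover have "x \<in> K" "K \<subseteq> {a..b}" using P(1) xK by blast+
    ultimately have uv: "x \<in> {a..b}" "a \<le> u" "u \<le> v" "v \<le> b" "K = {u..v}" by auto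
    thus "norm ((g (Sup K) - g (Inf K)) *\<^sub>R f x) \<le> M * (V (Sup K) - V (Inf K))"
      using variation_majorantD[OF V, of u v] M[of x] by (auto intro!: mult_mono simp: mult.commute[of M])
  qed
  also have "\<dots> = M * (\<Sum>(x,K)\<in>?p. V (Sup K) - V (Inf K))" by (simp add: sum_distrib_left split_def)
  also have "(\<Sum>(x,K)\<in>?p. V (Sup K) - V (Inf K)) = V b - V a"
    using additive_tagged_division_1[OF ab P(1), of V] .
  finally show "norm I \<le> M * (V b - V a) + e"
    using close norm_triangle_ineq2[of I "\<Sum>(x,K)\<in>?p. (g (Sup K) - g (Inf K)) *\<^sub>R f x"]
    by (simp add: norm_minus_commute)
qed

section \<open>The Fourier-Stieltjes transform\<close>

definition fourier_stieltjes :: "real \<Rightarrow> (real \<Rightarrow> real) \<Rightarrow> complex \<Rightarrow> complex" where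
  "fourier_stieltjes \<sigma> \<mu> z = stieltjes_integral 0 \<sigma> (\<lambda>t. exp (\<i> * z * complex_of_real t)) \<mu>"

lemma has_vector_derivative_exp_ii:
  "((\<lambda>t. exp (\<i> * z * complex_of_real t)) has_vector_derivative \<i> * z * exp (\<i> * z * complex_of_real t)) (at t within A)"
  by (rule has_vector_derivative_eq_rhs, rule has_vector_derivative_real_field)
     (auto intro!: derivative_eq_intros simp: mult_ac)

lemma fourier_stieltjes_has_integral:
  assumes "\<sigma> > 0" "variation_majorant V \<mu> 0 \<sigma>"
  shows "has_stieltjes_integral (\<lambda>t. exp (\<i> * z * complex_of_real t)) \<mu> (fourier_stieltjes \<sigma> \<mu> z) 0 \<sigma>"
    and "fourier_stieltjes \<sigma> \<mu> z = \<mu> \<sigma> *\<^sub>R exp (\<i> * z * \<sigma>) - \<mu> 0 *\<^sub>R 1 -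
      integral {0..\<sigma>} (\<lambda>t. \<mu> t *\<^sub>R (\<i> * z * exp (\<i> * z * t)))"
proof -
  have *: "has_stieltjes_integral (\<lambda>t. exp (\<i> * z * complex_of_real t)) \<mu> (\<mu> \<sigma> *\<^sub>R exp (\<i> * z * \<sigma>) - \<mu> 0 *\<^sub>R exp (\<i> * z * complex_of_real 0) -
      integral {0..\<sigma>} (\<lambda>t. \<mu> t *\<^sub>R (\<i> * z * exp (\<i> * z * t)))) 0 \<sigma>"
    using assms(1)
    by (intro has_stieltjes_integral_by_parts[OF _ assms(2)] has_vector_derivative_exp_ii continuous_intros) auto
  from stieltjes_integral_eqI[OF this] * show "has_stieltjes_integral (\<lambda>t. exp (\<i> * z * complex_of_real t)) \<mu> (fourier_stieltjes \<sigma> \<mu> z) 0 \<sigma>"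
    and "fourier_stieltjes \<sigma> \<mu> z = \<mu> \<sigma> *\<^sub>R exp (\<i> * z * \<sigma>) - \<mu> 0 *\<^sub>R 1 -
      integral {0..\<sigma>} (\<lambda>t. \<mu> t *\<^sub>R (\<i> * z * exp (\<i> * z * t)))"
    by (simp_all add: fourier_stieltjes_def)
qed

lemma fourier_stieltjes_0:
  assumes "\<sigma> > 0" "variation_majorant V \<mu> 0 \<sigma>"
  shows "fourier_stieltjes \<sigma> \<mu> 0 = of_real (\<mu> \<sigma> - \<mu> 0)"
  using fourier_stieltjes_has_integral(2)[OF assms, of 0] by (simp add: scaleR_conv_of_real)

lemma fourier_stieltjes_cnj:
  assumes "\<sigma> > 0" "variation_majorant V \<mu> 0 \<sigma>"
  shows "fourier_stieltjes \<sigma> \<mu> (- cnj z) = cnj (fourier_stieltjes \<sigma> \<mu> z)"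
proof -
  have "cnj (integral {0..\<sigma>} (\<lambda>t. \<mu> t *\<^sub>R (\<i> * z * exp (\<i> * z * t)))) =
     integral {0..\<sigma>} (\<lambda>t. \<mu> t *\<^sub>R (\<i> * (- cnj z) * exp (\<i> * (- cnj z) * t)))"
    by (subst integral_cnj) (simp add: exp_cnj)
  thus ?thesis
    by (simp add: fourier_stieltjes_has_integral(2)[OF assms] exp_cnj)
qed

lemma fourier_stieltjes_norm_le:
  assumes "\<sigma> > 0" "variation_majorant V \<mu> 0 \<sigma>" "Im z \<ge> 0"
  shows "norm (fourier_stieltjes \<sigma> \<mu> z) \<le> V \<sigma> - V 0"
proof -
  have "norm (fourier_stieltjes \<sigma> \<mu> z) \<le> 1 * (V \<sigma> - V 0)"
    using assms by (intro stieltjes_integral_norm_le[OF _ _ fourier_stieltjes_has_integral(1)]) auto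
  thus ?thesis by simp
qed

text \<open>On \<open>[0, \<sigma>]\<close> the kernel of \<open>F (- z)\<close> has modulus at most \<open>exp (\<sigma> Im z)\<close>, and the factor
  \<open>exp (\<i> \<sigma> z)\<close> cancels exactly this growth.\<close>

lemma fourier_stieltjes_reflected_norm_le:
  assumes "\<sigma> > 0" "variation_majorant V \<mu> 0 \<sigma>" "Im z \<ge> 0"
  shows "norm (exp (\<i> * \<sigma> * z) * fourier_stieltjes \<sigma> \<mu> (- z)) \<le> V \<sigma> - V 0"
proof -
  have "norm (fourier_stieltjes \<sigma> \<mu> (- z)) \<le> exp (\<sigma> * Im z) * (V \<sigma> - V 0)"
    using assms
    by (intro stieltjes_integral_norm_le[OF _ _ fourier_stieltjes_has_integral(1)])
       (auto simp: mult_left_mono mult.commute[of _ "Im z"])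
  hence "exp (- \<sigma> * Im z) * norm (fourier_stieltjes \<sigma> \<mu> (- z)) \<le> exp (- \<sigma> * Im z) * (exp (\<sigma> * Im z) * (V \<sigma> - V 0))"
    by (intro mult_left_mono) auto
  also have "\<dots> = V \<sigma> - V 0" by (simp add: mult.assoc[symmetric] flip: exp_add)
  finally show ?thesis by (simp add: norm_mult)
qed

text \<open>The Stieltjes sums are finite combinations of exponentials, and the error estimate makes their
  convergence locally uniform, since \<open>norm (\<i> * z * exp (\<i> * z * t))\<close> is bounded for bounded \<open>z\<close>.\<close>

lemma fourier_stieltjes_holomorphic:
  assumes "\<sigma> > 0" "variation_majorant V \<mu> 0 \<sigma>"
  shows "fourier_stieltjes \<sigma> \<mu> holomorphic_on A"
proof -
  obtain P where "\<forall>n::nat. P n tagged_division_of {0..\<sigma>} \<and> (\<forall>(x,K)\<in>P n. Sup K - Inf K \<le> 1 / (real n + 1))"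
    using fine_tagged_divisions[of 0 \<sigma>] ..
  hence P: "\<And>n. P n tagged_division_of {0..\<sigma>}"
    "\<And>n::nat. \<forall>(x,K)\<in>P n. Sup K - Inf K \<le> 1 / (real n + 1)" by auto
  define s where "s n z = (\<Sum>(x,K)\<in>P n. (\<mu> (Sup K) - \<mu> (Inf K)) *\<^sub>R exp (\<i> * z * complex_of_real x))" for n z
  have "fourier_stieltjes \<sigma> \<mu> holomorphic_on UNIV"
  proof (rule holomorphic_uniform_sequence[of _ s])
    show "s n holomorphic_on UNIV" for n
      unfolding s_def split_def scaleR_conv_of_real by (intro holomorphic_intros)
    fix w :: complex
    define R where "R = norm w + 1"
    have R: "R > 0" by (simp add: R_def add_nonneg_pos)
    define c where "c = R * exp (R * \<sigma>) * (V \<sigma> - V 0)"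
    have err: "norm (s n z - fourier_stieltjes \<sigma> \<mu> z) \<le> 1 / (real n + 1) * c" if z: "norm z \<le> R" for n z
    proof -
      have L: "norm (\<i> * z * exp (\<i> * z * complex_of_real t)) \<le> R * exp (R * \<sigma>)" if t: "t \<in> {0..\<sigma>}" for t
      proof -
        have "- Im z * t \<le> R * \<sigma>"
          using t z abs_Im_le_cmod[of z] by (intro mult_mono) auto
        thus ?thesis using z R by (auto simp: norm_mult intro!: mult_mono)
      qed
      have "norm (s n z - (\<mu> \<sigma> *\<^sub>R exp (\<i> * z * \<sigma>) - \<mu> 0 *\<^sub>R exp (\<i> * z * complex_of_real 0) -
          integral {0..\<sigma>} (\<lambda>t. \<mu> t *\<^sub>R (\<i> * z * exp (\<i> * z * t))))) \<le> 1 / (real n + 1) * (R * exp (R * \<sigma>)) * (V \<sigma> - V 0)"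
        unfolding s_def using assms(1)
        by (intro stieltjes_sum_error[OF _ assms(2) has_vector_derivative_exp_ii _ L P(1) P(2)] continuous_intros) auto
      thus ?thesis by (simp add: fourier_stieltjes_has_integral(2)[OF assms] c_def)
    qed
    have "uniform_limit (cball w 1) s (fourier_stieltjes \<sigma> \<mu>) sequentially"
    proof (rule uniform_limitI)
      fix e :: real assume e: "e > 0"
      have "(\<lambda>n. 1 / (real n + 1) * c) \<longlonglongrightarrow> 0 * c"
        by (intro tendsto_intros) (use LIMSEQ_inverse_real_of_nat in \<open>simp add: inverse_eq_divide add.commute\<close>)
      hence "\<forall>\<^sub>F n in sequentially. 1 / (real n + 1) * c < e"
        using e order_tendstoD(2) by (metis mult_zero_left)
      thus "\<forall>\<^sub>F n in sequentially. \<forall>z\<in>cball w 1. dist (s n z) (fourier_stieltjes \<sigma> \<mu> z) < e"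
      proof eventually_elim
        case (elim n)
        show ?case
        proof
          fix z assume "z \<in> cball w 1"
          hence "norm z \<le> R" using norm_triangle_ineq2[of z w] by (simp add: R_def dist_norm norm_minus_commute)
          from err[OF this, of n] elim show "dist (s n z) (fourier_stieltjes \<sigma> \<mu> z) < e"
            by (simp add: dist_norm)
        qed
      qed
    qed
    thus "\<exists>d>0. cball w d \<subseteq> UNIV \<and> uniform_limit (cball w d) s (fourier_stieltjes \<sigma> \<mu>) sequentially"
      by (intro exI[of _ 1]) auto
  qed auto
  thus ?thesis using holomorphic_on_subset by blast
qed

lemma has_integral_reflect_interval:
  fixes h :: "real \<Rightarrow> complex"
  assumes "(h has_integral i) {0..\<sigma>}" "\<sigma> > 0"
  shows "((\<lambda>t. h (\<sigma> - t)) has_integral i) {0..\<sigma>}"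
proof -
  have "((\<lambda>t. h ((-1) *\<^sub>R t + \<sigma>)) has_integral (1 / \<bar>-1\<bar> ^ DIM(real)) *\<^sub>R i)
      ((\<lambda>t. (1 / (-1)) *\<^sub>R t + - ((1 / (-1)) *\<^sub>R \<sigma>)) ` cbox 0 \<sigma>)"
    using assms by (intro has_integral_affinity) auto
  moreover have "(\<lambda>t. (1 / (-1)) *\<^sub>R t + - ((1 / (-1)) *\<^sub>R \<sigma>)) ` cbox 0 \<sigma> = {0..\<sigma>}"
    using assms(2) image_affinity_atLeastAtMost[of "-1" \<sigma> 0 \<sigma>] by simp
  ultimately show ?thesis by simp
qed

lemma integral_reflect_interval:
  fixes h :: "real \<Rightarrow> complex"
  assumes "h integrable_on {0..\<sigma>}" "\<sigma> > 0"
  shows "integral {0..\<sigma>} (\<lambda>t. h (\<sigma> - t)) = integral {0..\<sigma>} h"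
  using has_integral_reflect_interval[OF integrable_integral[OF assms(1)] assms(2)] by (rule integral_unique)

lemma fourier_stieltjes_reflected_by_parts:
  assumes "\<sigma> > 0" "variation_majorant V \<mu> 0 \<sigma>"
  shows "exp (\<i> * \<sigma> * z) * fourier_stieltjes \<sigma> \<mu> (- z) = \<mu> \<sigma> - \<mu> 0 * exp (\<i> * \<sigma> * z) +
      \<i> * z * integral {0..\<sigma>} (\<lambda>t. \<mu> t *\<^sub>R exp (\<i> * z * (\<sigma> - t)))"
proof -
  let ?E = "exp (\<i> * \<sigma> * z)"
  have "?E * integral {0..\<sigma>} (\<lambda>t. \<mu> t *\<^sub>R (\<i> * (- z) * exp (\<i> * (- z) * t))) =
      integral {0..\<sigma>} (\<lambda>t. ?E * (\<mu> t *\<^sub>R (\<i> * (- z) * exp (\<i> * (- z) * t))))"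
    by (rule Henstock_Kurzweil_Integration.integral_mult_right[symmetric])
  also have "\<dots> = integral {0..\<sigma>} (\<lambda>t. (- \<i> * z) * (\<mu> t *\<^sub>R exp (\<i> * z * (\<sigma> - t))))"
    by (intro Henstock_Kurzweil_Integration.integral_cong)
       (simp add: scaleR_conv_of_real exp_diff exp_minus algebra_simps divide_inverse)
  also have "\<dots> = - \<i> * z * integral {0..\<sigma>} (\<lambda>t. \<mu> t *\<^sub>R exp (\<i> * z * (\<sigma> - t)))"
    by (rule Henstock_Kurzweil_Integration.integral_mult_right)
  finally have I: "?E * integral {0..\<sigma>} (\<lambda>t. \<mu> t *\<^sub>R (\<i> * (- z) * exp (\<i> * (- z) * t))) =
      - \<i> * z * integral {0..\<sigma>} (\<lambda>t. \<mu> t *\<^sub>R exp (\<i> * z * (\<sigma> - t)))" .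
  have e: "?E * exp (\<i> * (- z) * \<sigma>) = 1"
    by (simp flip: exp_add)
  show ?thesis
    unfolding fourier_stieltjes_has_integral(2)[OF assms]
    by (simp only: right_diff_distrib I) (use e in \<open>simp add: scaleR_conv_of_real algebra_simps\<close>)
qed

text \<open>The sine of \<open>z (\<sigma> - t)\<close> is the difference of two exponentials. The reflection \<open>t \<mapsto> \<sigma> - t\<close> is carried out on
  the ordinary integrals that remain after integrating by parts.\<close>

lemma sine_stieltjes_eq:
  assumes "\<sigma> > 0" "variation_majorant V \<mu> 0 \<sigma>"
  shows "2 * \<i> * stieltjes_integral 0 \<sigma> (\<lambda>t. sin (z * complex_of_real t)) (\<lambda>t. \<mu> (\<sigma> - t)) =
    exp (\<i> * \<sigma> * (- z)) * fourier_stieltjes \<sigma> \<mu> z - exp (\<i> * \<sigma> * z) * fourier_stieltjes \<sigma> \<mu> (- z)"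
proof -
  have maj: "variation_majorant (\<lambda>t. - V (\<sigma> - t)) (\<lambda>t. \<mu> (\<sigma> - t)) 0 \<sigma>"
    unfolding variation_majorant_def
  proof (intro allI impI)
    fix s t :: real assume "0 \<le> s" "s \<le> t" "t \<le> \<sigma>"
    thus "\<bar>\<mu> (\<sigma> - t) - \<mu> (\<sigma> - s)\<bar> \<le> - V (\<sigma> - t) - - V (\<sigma> - s)"
      using variation_majorantD[OF assms(2), of "\<sigma> - t" "\<sigma> - s"] by (simp add: abs_minus_commute)
  qed
  have der: "((\<lambda>t. sin (z * complex_of_real t)) has_vector_derivative z * cos (z * complex_of_real t)) (at t within A)" for t A
    by (rule has_vector_derivative_eq_rhs, rule has_vector_derivative_real_field)
     (auto intro!: derivative_eq_intros simp: mult_ac)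
  have int: "(\<lambda>t. \<mu> t *\<^sub>R h t) integrable_on {0..\<sigma>}" if "continuous_on {0..\<sigma>} h" for h :: "real \<Rightarrow> complex"
    using variation_majorant_continuous_product_integrable[OF assms(2) that] .
  have "stieltjes_integral 0 \<sigma> (\<lambda>t. sin (z * complex_of_real t)) (\<lambda>t. \<mu> (\<sigma> - t)) =
     \<mu> (\<sigma> - \<sigma>) *\<^sub>R sin (z * \<sigma>) - \<mu> (\<sigma> - 0) *\<^sub>R sin (z * complex_of_real 0) -
       integral {0..\<sigma>} (\<lambda>t. \<mu> (\<sigma> - t) *\<^sub>R (z * cos (z * complex_of_real t)))"
    using assms(1)
    by (intro stieltjes_integral_eqI has_stieltjes_integral_by_parts[OF _ maj der] continuous_intros) auto
  also have "integral {0..\<sigma>} (\<lambda>t. \<mu> (\<sigma> - t) *\<^sub>R (z * cos (z * complex_of_real t))) =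
      integral {0..\<sigma>} (\<lambda>t. \<mu> t *\<^sub>R (z * cos (z * (\<sigma> - t))))"
    using integral_reflect_interval[OF int assms(1), of "\<lambda>t. z * cos (z * (\<sigma> - t))"]
    by (force intro!: continuous_intros)
  also have "\<dots> = z * integral {0..\<sigma>} (\<lambda>t. \<mu> t *\<^sub>R cos (z * (\<sigma> - t)))"
    by (simp only: mult_scaleR_right[symmetric] Henstock_Kurzweil_Integration.integral_mult_right)
  finally have S: "stieltjes_integral 0 \<sigma> (\<lambda>t. sin (z * complex_of_real t)) (\<lambda>t. \<mu> (\<sigma> - t)) =
     \<mu> 0 * sin (z * \<sigma>) - z * integral {0..\<sigma>} (\<lambda>t. \<mu> t *\<^sub>R cos (z * (\<sigma> - t)))"
    by (simp add: scaleR_conv_of_real)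
  have "integral {0..\<sigma>} (\<lambda>t. \<mu> t *\<^sub>R exp (\<i> * z * (\<sigma> - t))) + integral {0..\<sigma>} (\<lambda>t. \<mu> t *\<^sub>R exp (\<i> * (- z) * (\<sigma> - t)))
     = integral {0..\<sigma>} (\<lambda>t. \<mu> t *\<^sub>R exp (\<i> * z * (\<sigma> - t)) + \<mu> t *\<^sub>R exp (\<i> * (- z) * (\<sigma> - t)))"
    by (intro Henstock_Kurzweil_Integration.integral_add[symmetric] int continuous_intros)
  also have "\<dots> = integral {0..\<sigma>} (\<lambda>t. 2 * (\<mu> t *\<^sub>R cos (z * (\<sigma> - t))))"
    by (intro Henstock_Kurzweil_Integration.integral_cong)
       (simp add: cos_exp_eq scaleR_conv_of_real algebra_simps)
  finally have C: "integral {0..\<sigma>} (\<lambda>t. \<mu> t *\<^sub>R exp (\<i> * z * (\<sigma> - t))) + integral {0..\<sigma>} (\<lambda>t. \<mu> t *\<^sub>R exp (\<i> * (- z) * (\<sigma> - t)))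
     = 2 * integral {0..\<sigma>} (\<lambda>t. \<mu> t *\<^sub>R cos (z * (\<sigma> - t)))"
    by (simp only: Henstock_Kurzweil_Integration.integral_mult_right)
  let ?A = "integral {0..\<sigma>} (\<lambda>t. \<mu> t *\<^sub>R exp (\<i> * z * (\<sigma> - t)))"
  let ?B = "integral {0..\<sigma>} (\<lambda>t. \<mu> t *\<^sub>R exp (\<i> * (- z) * (\<sigma> - t)))"
  have "exp (\<i> * \<sigma> * (- z)) * fourier_stieltjes \<sigma> \<mu> z - exp (\<i> * \<sigma> * z) * fourier_stieltjes \<sigma> \<mu> (- z) =
     \<mu> 0 * (exp (\<i> * \<sigma> * z) - exp (\<i> * \<sigma> * (- z))) - \<i> * z * (?A + ?B)"
    using fourier_stieltjes_reflected_by_parts[OF assms, of z] fourier_stieltjes_reflected_by_parts[OF assms, of "- z"]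
    by (simp add: algebra_simps)
  also have "exp (\<i> * \<sigma> * z) - exp (\<i> * \<sigma> * (- z)) = 2 * \<i> * sin (z * \<sigma>)"
    by (simp add: sin_exp_eq mult_ac)
  finally show ?thesis unfolding C S by (simp add: algebra_simps)
qed

text \<open>As \<open>y\<close> grows, \<open>y exp (- y (\<sigma> - t))\<close> is an approximate identity at the right end point, so the integral
  in the by-parts formula tends to the left limit of \<open>\<mu>\<close>, and only the jump at \<open>\<sigma>\<close> survives.\<close>

lemma fourier_stieltjes_reflected_limit:
  assumes "\<sigma> > 0" "variation_majorant V \<mu> 0 \<sigma>"
  shows "((\<lambda>y. exp (\<i> * \<sigma> * (\<i> * of_real y)) * fourier_stieltjes \<sigma> \<mu> (- (\<i> * of_real y))) \<longlongrightarrow>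
    of_real (\<mu> \<sigma> - Lim (at_left \<sigma>) \<mu>)) at_top"
proof (rule tendstoI)
  fix e :: real assume e: "e > 0"
  define m where "m = Lim (at_left \<sigma>) \<mu>"
  have lim: "(\<mu> \<longlongrightarrow> m) (at_left \<sigma>)" unfolding m_def using assms by (rule variation_majorant_left_limit)
  \<comment> \<open>Changing the value at the single point \<open>\<sigma>\<close> does not affect the integral, and makes \<open>\<nu>\<close> close to \<open>m\<close> up to \<open>\<sigma>\<close>.\<close>
  define \<nu> where "\<nu> t = (if t = \<sigma> then m else \<mu> t)" for t
  have "\<forall>\<^sub>F t in at_left \<sigma>. dist (\<mu> t) m < e / 2" using lim e by (intro tendstoD) auto
  then obtain s where s: "s < \<sigma>" "\<And>t. s < t \<Longrightarrow> t < \<sigma> \<Longrightarrow> dist (\<mu> t) m < e / 2"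
    by (auto simp: eventually_at_left_field)
  define d where "d = \<sigma> - s"
  have d: "d > 0" using s by (simp add: d_def)
  define C where "C = V \<sigma> - V 0 + \<bar>\<mu> 0 - m\<bar>"
  have V0: "V \<sigma> - V 0 \<ge> 0" using variation_majorantD[OF assms(2), of 0 \<sigma>] assms(1) by auto
  have C: "\<bar>\<nu> t - m\<bar> \<le> C" if "t \<in> {0..\<sigma>}" for t
    using variation_majorantD[OF assms(2), of 0 t] variation_majorantD[OF assms(2), of t \<sigma>] that V0
    by (auto simp: \<nu>_def C_def)
  have C0: "C \<ge> 0" using V0 by (simp add: C_def)
  let ?k = "\<lambda>y t. y * exp (- y * (\<sigma> - t))"
  have key: "norm (exp (\<i> * \<sigma> * (\<i> * of_real y)) * fourier_stieltjes \<sigma> \<mu> (- (\<i> * of_real y)) - of_real (\<mu> \<sigma> - m))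
      \<le> exp (- \<sigma> * y) * \<bar>m - \<mu> 0\<bar> + e / 2 + C * (y * exp (- y * d)) * \<sigma>" if y: "y > 0" for y
  proof -
    have k: "(?k y has_integral (1 - exp (- y * \<sigma>))) {0..\<sigma>}"
    proof -
      have "(?k y has_integral (exp (- y * (\<sigma> - \<sigma>)) - exp (- y * (\<sigma> - 0)))) {0..\<sigma>}"
        using assms(1)
        by (intro fundamental_theorem_of_calculus)
           (auto intro!: derivative_eq_intros simp flip: has_real_derivative_iff_has_vector_derivative)
      thus ?thesis by simp
    qed
    have exp_eq: "exp (\<i> * (\<i> * of_real y) * (of_real \<sigma> - of_real t)) = of_real (exp (- y * (\<sigma> - t)))" for t
      by (simp add: exp_of_real[symmetric] algebra_simps)
    have mint: "(\<lambda>t. \<mu> t *\<^sub>R complex_of_real (?k y t)) integrable_on {0..\<sigma>}"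
      by (intro variation_majorant_continuous_product_integrable[OF assms(2)] continuous_intros)
    have "\<i> * (\<i> * of_real y) * integral {0..\<sigma>} (\<lambda>t. \<mu> t *\<^sub>R exp (\<i> * (\<i> * of_real y) * (of_real \<sigma> - of_real t)))
        = - (of_real y * integral {0..\<sigma>} (\<lambda>t. \<mu> t *\<^sub>R complex_of_real (exp (- y * (\<sigma> - t)))))"
      unfolding exp_eq by simp
    also have "\<dots> = - integral {0..\<sigma>} (\<lambda>t. of_real y * (\<mu> t *\<^sub>R complex_of_real (exp (- y * (\<sigma> - t)))))"
      by (simp only: Henstock_Kurzweil_Integration.integral_mult_right)
    also have "(\<lambda>t. of_real y * (\<mu> t *\<^sub>R complex_of_real (exp (- y * (\<sigma> - t))))) = (\<lambda>t. \<mu> t *\<^sub>R complex_of_real (?k y t))"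
      by (simp add: scaleR_conv_of_real mult_ac)
    finally have i1: "\<i> * (\<i> * of_real y) * integral {0..\<sigma>} (\<lambda>t. \<mu> t *\<^sub>R exp (\<i> * (\<i> * of_real y) * (of_real \<sigma> - of_real t)))
        = - integral {0..\<sigma>} (\<lambda>t. \<mu> t *\<^sub>R complex_of_real (?k y t))" .
    define D where "D = integral {0..\<sigma>} (\<lambda>t. \<mu> t *\<^sub>R complex_of_real (?k y t)) - of_real (m * (1 - exp (- y * \<sigma>)))"
    have "((\<lambda>t. \<mu> t *\<^sub>R complex_of_real (?k y t) - of_real (m * ?k y t)) has_integral D) {0..\<sigma>}"
      unfolding D_def
      by (intro has_integral_diff integrable_integral mint has_integral_of_real has_integral_mult_right k)
    hence D: "((\<lambda>t. (\<nu> t - m) *\<^sub>R complex_of_real (?k y t)) has_integral D) {0..\<sigma>}"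
      by (rule has_integral_spike_finite[of "{\<sigma>}", rotated 2])
         (auto simp: \<nu>_def scaleR_conv_of_real algebra_simps)
    \<comment> \<open>The first summand dominates near \<open>\<sigma>\<close>, the second one for \<open>t \<le> s\<close>.\<close>
    have maj: "((\<lambda>t. (e / 2) * ?k y t + C * (y * exp (- y * d))) has_integral
        ((e / 2) * (1 - exp (- y * \<sigma>)) + \<sigma> * (C * (y * exp (- y * d))))) {0..\<sigma>}"
      using has_integral_const_real[of "C * (y * exp (- y * d))" 0 \<sigma>] assms(1)
      by (intro has_integral_add has_integral_mult_right k) auto
    have "norm D \<le> (e / 2) * (1 - exp (- y * \<sigma>)) + \<sigma> * (C * (y * exp (- y * d)))"
    proof -
      have "norm (integral {0..\<sigma>} (\<lambda>t. (\<nu> t - m) *\<^sub>R complex_of_real (?k y t))) \<le>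
          integral {0..\<sigma>} (\<lambda>t. (e / 2) * ?k y t + C * (y * exp (- y * d)))"
      proof (rule integral_norm_bound_integral)
        fix t assume t: "t \<in> {0..\<sigma>}"
        have k0: "?k y t \<ge> 0" using y by simp
        have "\<bar>\<nu> t - m\<bar> * ?k y t \<le> (e / 2) * ?k y t + C * (y * exp (- y * d))"
        proof (cases "s < t")
          case True
          hence "\<bar>\<nu> t - m\<bar> \<le> e / 2" using s(2)[of t] t e by (auto simp: \<nu>_def dist_real_def)
          hence "\<bar>\<nu> t - m\<bar> * ?k y t \<le> (e / 2) * ?k y t" using k0 by (intro mult_right_mono)
          moreover have "C * (y * exp (- y * d)) \<ge> 0" using C0 y by simp
          ultimately show ?thesis by linarith
        next
          case False
          hence "?k y t \<le> y * exp (- y * d)" using y by (auto simp: d_def)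
          hence "\<bar>\<nu> t - m\<bar> * ?k y t \<le> C * (y * exp (- y * d))"
            using C[OF t] k0 C0 by (rule_tac mult_mono)
          moreover have "(e / 2) * ?k y t \<ge> 0" using e k0 by simp
          ultimately show ?thesis by linarith
        qed
        thus "norm ((\<nu> t - m) *\<^sub>R complex_of_real (?k y t)) \<le> (e / 2) * ?k y t + C * (y * exp (- y * d))"
          using y by (simp add: norm_mult abs_mult)
      qed (use D maj in \<open>auto simp: has_integral_integrable\<close>)
      thus ?thesis using integral_unique[OF D] integral_unique[OF maj] by simp
    qed
    also have "\<dots> \<le> e / 2 + C * (y * exp (- y * d)) * \<sigma>"
      using e by (simp add: algebra_simps)
    finally have nD: "norm D \<le> e / 2 + C * (y * exp (- y * d)) * \<sigma>" .
    have "exp (\<i> * \<sigma> * (\<i> * of_real y)) = complex_of_real (exp (- \<sigma> * y))"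
      by (simp add: exp_of_real[symmetric] algebra_simps)
    hence "exp (\<i> * \<sigma> * (\<i> * of_real y)) * fourier_stieltjes \<sigma> \<mu> (- (\<i> * of_real y)) - of_real (\<mu> \<sigma> - m) =
        of_real (exp (- \<sigma> * y) * (m - \<mu> 0)) - D"
      using fourier_stieltjes_reflected_by_parts[OF assms, of "\<i> * of_real y"] i1
      by (simp add: D_def algebra_simps)
    also have "norm \<dots> \<le> norm (complex_of_real (exp (- \<sigma> * y) * (m - \<mu> 0))) + norm D"
      by (rule norm_triangle_ineq4)
    also have "norm (complex_of_real (exp (- \<sigma> * y) * (m - \<mu> 0))) = exp (- \<sigma> * y) * \<bar>m - \<mu> 0\<bar>"
      unfolding norm_of_real by (simp add: abs_mult)
    finally show ?thesis using nD by linarith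
  qed
  have "((\<lambda>y. exp (- \<sigma> * y) * \<bar>m - \<mu> 0\<bar> + e / 2 + C * (y * exp (- y * d)) * \<sigma>) \<longlongrightarrow> 0 * \<bar>m - \<mu> 0\<bar> + e / 2 + C * 0 * \<sigma>) at_top"
  proof (intro tendsto_intros)
    show "((\<lambda>y. exp (- \<sigma> * y)) \<longlongrightarrow> 0) at_top" using assms(1) by real_asymp
    show "((\<lambda>y. y * exp (- y * d)) \<longlongrightarrow> 0) at_top" using d by real_asymp
  qed
  from order_tendstoD(2)[OF this, of e] e
  have "\<forall>\<^sub>F y in at_top. exp (- \<sigma> * y) * \<bar>m - \<mu> 0\<bar> + e / 2 + C * (y * exp (- y * d)) * \<sigma> < e"
    by simp
  thus "\<forall>\<^sub>F y in at_top. dist (exp (\<i> * \<sigma> * (\<i> * of_real y)) * fourier_stieltjes \<sigma> \<mu> (- (\<i> * of_real y)))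
      (of_real (\<mu> \<sigma> - Lim (at_left \<sigma>) \<mu>)) < e"
    using eventually_gt_at_top[of 0]
  proof eventually_elim
    case (elim y)
    thus ?case using key[of y] unfolding dist_norm m_def by linarith
  qed
qed

section \<open>A Phragmen-Lindelof principle, and zeros in sectors\<close>

text \<open>Dividing by \<open>1 - \<i> e z\<close>, whose modulus is at least \<open>1\<close> in the upper half-plane and grows linearly, makes the
  function small on large circles, so that the maximum principle applies on a bounded piece; then \<open>e\<close>
  tends to \<open>0\<close>.\<close>

lemma Phragmen_Lindelof_bounded:
  assumes S: "closed S" "S \<subseteq> {z. Im z \<ge> 0}"
    and f: "continuous_on S f" "f holomorphic_on interior S"
    and bound: "\<And>z. z \<in> S \<Longrightarrow> norm (f z) \<le> M"
    and boundary: "\<And>z. z \<in> frontier S \<Longrightarrow> norm (f z) \<le> 1"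
    and z: "z \<in> S"
  shows "norm (f z) \<le> 1"
proof -
  have le: "norm (f z) \<le> norm (1 - \<i> * of_real e * z)" if e: "e > 0" for e
  proof -
    define d where "d w = 1 - \<i> * of_real e * w" for w :: complex
    have d1: "norm (d w) \<ge> 1" if "w \<in> S" for w
    proof -
      have "Re (d w) \<ge> 1" using that S(2) e by (auto simp: d_def)
      thus ?thesis using complex_Re_le_cmod[of "d w"] by linarith
    qed
    have dR: "norm (d w) \<ge> e * norm w - 1" for w
      using norm_triangle_ineq2[of "\<i> * of_real e * w" 1] e
      by (simp add: d_def norm_mult norm_minus_commute)
    have M: "M \<ge> 0" using bound[OF z] norm_ge_zero order_trans by blast
    \<comment> \<open>\<open>R\<close> is so large that the denominator is at least \<open>M\<close> in modulus on the circle of radius \<open>R\<close>.\<close>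
    define R where "R = max (norm z) ((M + 1) / e)"
    have R: "norm z \<le> R" "e * R - 1 \<ge> M" using e by (auto simp: R_def field_simps max_def)
    have clo: "closed (S \<inter> cball 0 R)" using S(1) by (intro closed_Int) auto
    have "norm (f z / d z) \<le> 1"
    proof (rule maximum_modulus_frontier[where S = "S \<inter> cball 0 R" and f = "\<lambda>w. f w / d w"])
      have dne: "d w \<noteq> 0" if "w \<in> S" for w using d1[OF that] by auto
      have int: "interior (S \<inter> cball 0 R) \<subseteq> interior S" by (intro interior_mono) auto
      show "(\<lambda>w. f w / d w) holomorphic_on interior (S \<inter> cball 0 R)"
        using dne interior_subset[of S] int
        by (intro holomorphic_on_divide holomorphic_on_subset[OF f(2)])
           (auto simp: d_def intro!: holomorphic_intros)
      show "continuous_on (closure (S \<inter> cball 0 R)) (\<lambda>w. f w / d w)"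
        using clo dne
        by (auto intro!: continuous_on_divide continuous_on_subset[OF f(1)] continuous_intros simp: d_def[abs_def])
      show "bounded (S \<inter> cball 0 R)" by (intro bounded_Int) auto
      show "z \<in> S \<inter> cball 0 R" using z R by auto
      fix w assume w: "w \<in> frontier (S \<inter> cball 0 R)"
      have wS: "w \<in> S" using w clo frontier_subset_closed by blast
      have "w \<in> frontier S \<or> w \<in> frontier (cball 0 R)"
        using w frontier_Int_subset[of S "cball 0 R"] by blast
      hence "norm (f w) \<le> norm (d w)"
      proof
        assume "w \<in> frontier S"
        thus ?thesis using boundary[of w] d1[OF wS] by linarith
      next
        assume "w \<in> frontier (cball 0 R)"
        hence "norm w = R" using frontier_cball[of "0::complex" R] by (auto simp: sphere_def)
        thus ?thesis using bound[OF wS] dR[of w] R by simp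
      qed
      thus "norm (f w / d w) \<le> 1" using d1[OF wS] by (simp add: norm_divide divide_simps)
    qed
    thus ?thesis using d1[OF z] by (simp add: norm_divide d_def divide_simps split: if_splits)
  qed
  have "((\<lambda>e. norm (1 - \<i> * of_real e * z)) \<longlongrightarrow> norm (1 - \<i> * of_real 0 * z)) (at_right 0)"
    by (intro tendsto_intros)
  moreover have "\<forall>\<^sub>F e in at_right 0. norm (f z) \<le> norm (1 - \<i> * of_real e * z)"
    using le by (auto simp: eventually_at_right_less intro: eventually_at_rightI[of 0 1])
  ultimately have "norm (f z) \<le> norm (1 - \<i> * of_real 0 * z)"
    by (intro tendsto_lowerbound) auto
  thus ?thesis by simp
qed

text \<open>If \<open>sin\<close> were nonnegative on \<open>(a, b)\<close> then both \<open>sin t \<ge> 0\<close> and \<open>sin (t + pi) = - sin t \<ge> 0\<close> would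
  hold for all \<open>t\<close> in the nonempty interval \<open>(a, b - pi)\<close>, and \<open>sin\<close> would vanish there.\<close>

lemma sin_negative_exists:
  fixes a b :: real
  assumes "b - a > pi"
  obtains t where "a < t" "t < b" "sin t < 0"
proof -
  have "\<exists>t. a < t \<and> t < b \<and> sin t < 0"
  proof (rule ccontr)
    assume no: "\<nexists>t. a < t \<and> t < b \<and> sin t < 0"
    define c where "c = min (b - pi) (a + pi)"
    have z: "sin t = 0" if "a < t" "t < c" for t
    proof -
      have "\<not> (a < t \<and> t < b \<and> sin t < 0)" "\<not> (a < t + pi \<and> t + pi < b \<and> sin (t + pi) < 0)"
        using no by blast+
      hence "sin t \<ge> 0" "sin (t + pi) \<ge> 0"
        using that pi_gt_zero by (auto simp: c_def)
      thus ?thesis by simp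
    qed
    have ac: "a < c" "c \<le> a + pi" using assms pi_gt_zero by (auto simp: c_def)
    define u v where "u = (2 * a + c) / 3" and "v = (a + 2 * c) / 3"
    have uv: "a < u" "u < v" "v < c" "v - u < pi" "v - u > 0"
      using ac pi_gt_zero by (auto simp: u_def v_def field_simps)
    have "sin (v - u) = 0" using z[of u] z[of v] uv by (simp add: sin_diff)
    thus False using sin_gt_zero[of "v - u"] uv by simp
  qed
  thus ?thesis using that by blast
qed

text \<open>Along the ray of direction \<open>\<theta>\<close> the argument of \<open>q(z) (z - \<xi>)^n\<close> tends to \<open>Arg (q \<xi>) + n \<theta>\<close>. Over the whole
  sector these limits fill an interval of length \<open>n (\<beta> - \<alpha>)\<close>, which must avoid the directions with
  negative imaginary part.\<close>

lemma order_sector_bound: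
  assumes q: "isCont q \<xi>" "q \<xi> \<noteq> 0" and r: "r > 0"
    and sector: "\<And>\<rho> \<theta>. 0 < \<rho> \<Longrightarrow> \<rho> < r \<Longrightarrow> \<alpha> < \<theta> \<Longrightarrow> \<theta> < \<beta> \<Longrightarrow>
      Im (q (\<xi> + of_real \<rho> * cis \<theta>) * (of_real \<rho> * cis \<theta>) ^ n) \<ge> 0"
  shows "real n * (\<beta> - \<alpha>) \<le> pi"
proof (rule ccontr)
  assume "\<not> real n * (\<beta> - \<alpha>) \<le> pi"
  hence big: "(Arg (q \<xi>) + n * \<beta>) - (Arg (q \<xi>) + n * \<alpha>) > pi" by (simp add: algebra_simps)
  then obtain t where t: "Arg (q \<xi>) + n * \<alpha> < t" "t < Arg (q \<xi>) + n * \<beta>" "sin t < 0"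
    using sin_negative_exists by blast
  have n: "n > 0" using t by (cases n) auto
  define \<theta> where "\<theta> = (t - Arg (q \<xi>)) / n"
  have th: "\<alpha> < \<theta>" "\<theta> < \<beta>" using t n by (auto simp: \<theta>_def field_simps)
  have nth: "real n * \<theta> = t - Arg (q \<xi>)" using n by (simp add: \<theta>_def)
  have "((\<lambda>\<rho>. Im (q (\<xi> + of_real \<rho> * cis \<theta>) * cis \<theta> ^ n)) \<longlongrightarrow> Im (q (\<xi> + of_real 0 * cis \<theta>) * cis \<theta> ^ n)) (at_right 0)"
    by (intro tendsto_intros isCont_tendsto_compose[OF q(1)]) 
       (use q(1) in \<open>auto intro!: tendsto_eq_intros isCont_tendsto_compose[of _ q]\<close>)
  moreover have "\<forall>\<^sub>F \<rho> in at_right 0. Im (q (\<xi> + of_real \<rho> * cis \<theta>) * cis \<theta> ^ n) \<ge> 0"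
  proof (rule eventually_at_rightI[of 0 r])
    fix \<rho> assume \<rho>: "\<rho> \<in> {0<..<r}"
    have "q (\<xi> + of_real \<rho> * cis \<theta>) * (of_real \<rho> * cis \<theta>) ^ n =
        of_real (\<rho> ^ n) * (q (\<xi> + of_real \<rho> * cis \<theta>) * cis \<theta> ^ n)"
      by (simp add: power_mult_distrib)
    hence "Im (q (\<xi> + of_real \<rho> * cis \<theta>) * (of_real \<rho> * cis \<theta>) ^ n) =
        \<rho> ^ n * Im (q (\<xi> + of_real \<rho> * cis \<theta>) * cis \<theta> ^ n)"
      by (simp only: add_0_right Im_complex_of_real Re_complex_of_real mult_zero_left times_complex.sel)
    hence "0 \<le> \<rho> ^ n * Im (q (\<xi> + of_real \<rho> * cis \<theta>) * cis \<theta> ^ n)"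
      using sector[of \<rho> \<theta>] \<rho> th by auto
    thus "Im (q (\<xi> + of_real \<rho> * cis \<theta>) * cis \<theta> ^ n) \<ge> 0"
      using \<rho> zero_less_power[of \<rho> n]
      by (metis greaterThanLessThan_iff linorder_not_le mult_pos_neg)
  qed (use r in auto)
  ultimately have "0 \<le> Im (q (\<xi> + of_real 0 * cis \<theta>) * cis \<theta> ^ n)"
    by (intro tendsto_lowerbound) auto
  also have "q (\<xi> + of_real 0 * cis \<theta>) * cis \<theta> ^ n = rcis (norm (q \<xi>)) (Arg (q \<xi>)) * cis (real n * \<theta>)"
    by (simp add: rcis_cmod_Arg Complex.DeMoivre)
  also have "\<dots> = rcis (norm (q \<xi>)) t"
    by (simp add: nth rcis_def cis_mult mult.assoc)
  finally have "0 \<le> norm (q \<xi>) * sin t" by (simp add: rcis_def)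
  thus False using q(2) t(3) by (simp add: zero_le_mult_iff)
qed

lemma zorder_factorization:
  assumes "f holomorphic_on UNIV" "\<exists>z. f z \<noteq> 0"
  obtains g r where "zorder f \<xi> \<ge> 0" "r > 0" "g holomorphic_on cball \<xi> r"
    "\<forall>w\<in>cball \<xi> r. f w = g w * (w - \<xi>) ^ nat (zorder f \<xi>) \<and> g w \<noteq> 0"
proof -
  have "\<exists>w\<in>UNIV. f w \<noteq> 0" using assms(2) by blast
  note z = zorder_exist_zero[OF assms(1) open_UNIV connected_UNIV UNIV_I this, of \<xi>]
  have "zorder f \<xi> \<ge> 0" using conjunct1[OF z] by (cases "f \<xi> = 0") simp_all
  moreover obtain r where "r > 0" "zor_poly f \<xi> holomorphic_on cball \<xi> r"
    "\<forall>w\<in>cball \<xi> r. f w = zor_poly f \<xi> w * (w - \<xi>) ^ nat (zorder f \<xi>) \<and> zor_poly f \<xi> w \<noteq> 0"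
    using conjunct2[OF z] by (elim exE conjE)
  ultimately show ?thesis by (intro that)
qed

text \<open>The constant \<open>c\<close> lets the same lemma serve regions where the imaginary part of \<open>f\<close> is nonpositive.\<close>

lemma zorder_sector_bound:
  assumes f: "f holomorphic_on UNIV" "\<exists>z. f z \<noteq> 0" and c: "c \<noteq> 0" and r: "r > 0"
    and sector: "\<And>\<rho> \<theta>. 0 < \<rho> \<Longrightarrow> \<rho> < r \<Longrightarrow> \<alpha> < \<theta> \<Longrightarrow> \<theta> < \<beta> \<Longrightarrow>
      Im (c * f (\<xi> + of_real \<rho> * cis \<theta>)) \<ge> 0"
  shows "of_int (zorder f \<xi>) * (\<beta> - \<alpha>) \<le> pi"
proof -
  define n where "n = zorder f \<xi>"
  obtain g s where n: "n \<ge> 0" and s12: "s > 0" "g holomorphic_on cball \<xi> s" and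
    factored: "\<forall>w\<in>cball \<xi> s. f w = g w * (w - \<xi>) ^ nat n \<and> g w \<noteq> 0"
    by (rule zorder_factorization[OF f, of \<xi>, folded n_def], rule that)
  have s: "s > 0" "g holomorphic_on cball \<xi> s"
    "\<And>w. w \<in> cball \<xi> s \<Longrightarrow> f w = g w * (w - \<xi>) ^ nat n"
    "\<And>w. w \<in> cball \<xi> s \<Longrightarrow> g w \<noteq> 0"
    using s12 bspec[OF factored] by blast+
  have "real (nat n) * (\<beta> - \<alpha>) \<le> pi"
  proof (rule order_sector_bound[where q = "\<lambda>w. c * g w" and \<xi> = \<xi> and r = "min r s"])
    have "isCont g \<xi>"
      using holomorphic_on_imp_continuous_on[OF s(2)] s(1)
      by (intro continuous_on_interior[of "cball \<xi> s"]) auto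
    thus "isCont (\<lambda>w. c * g w) \<xi>" by simp
    show "c * g \<xi> \<noteq> 0" using s(1) s(4)[of \<xi>] c by simp
    show "min r s > 0" using r s by simp
    fix \<rho> \<theta> assume *: "0 < \<rho>" "\<rho> < min r s" "\<alpha> < \<theta>" "\<theta> < \<beta>"
    have "\<xi> + of_real \<rho> * cis \<theta> \<in> cball \<xi> s" using * by (simp add: dist_norm norm_mult)
    from s(3)[OF this]
    have "f (\<xi> + of_real \<rho> * cis \<theta>) = g (\<xi> + of_real \<rho> * cis \<theta>) * (of_real \<rho> * cis \<theta>) ^ nat n"
      by (simp only: add_diff_cancel_left')
    thus "0 \<le> Im (c * g (\<xi> + of_real \<rho> * cis \<theta>) * (of_real \<rho> * cis \<theta>) ^ nat n)"
      using sector[of \<rho> \<theta>] * by (simp only: mult.assoc)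
  qed
  thus ?thesis using n by (simp add: n_def)
qed

lemma zorder_pos_at_zero:
  assumes "f holomorphic_on UNIV" "\<exists>z. f z \<noteq> 0" "f \<xi> = 0"
  shows "zorder f \<xi> \<ge> 1"
proof -
  have "if f \<xi> = 0 then zorder f \<xi> > 0 else zorder f \<xi> = 0"
    using zorder_exist_zero[of f UNIV \<xi>] assms(1,2) by blast
  thus ?thesis using assms(3) by simp
qed

lemma deriv_nonzero_if_zorder_1:
  assumes "f holomorphic_on UNIV" "\<exists>z. f z \<noteq> 0" "zorder f \<xi> = 1"
  shows "deriv f \<xi> \<noteq> 0"
proof -
  obtain g s where s12: "s > 0" "g holomorphic_on cball \<xi> s" and
    factored: "\<forall>w\<in>cball \<xi> s. f w = g w * (w - \<xi>) ^ nat (zorder f \<xi>) \<and> g w \<noteq> 0"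
    by (rule zorder_factorization[OF assms(1,2), of \<xi>], rule that)
  have s: "s > 0" "g holomorphic_on cball \<xi> s"
    "\<And>w. w \<in> cball \<xi> s \<Longrightarrow> f w = g w * (w - \<xi>)"
    "\<And>w. w \<in> cball \<xi> s \<Longrightarrow> g w \<noteq> 0"
    using s12 bspec[OF factored] unfolding assms(3) by simp_all
  have "g field_differentiable at \<xi>"
    using holomorphic_on_subset[OF s(2), of "ball \<xi> s"] s(1) holomorphic_on_imp_differentiable_at[of g "ball \<xi> s" \<xi>] by auto
  hence "(g has_field_derivative deriv g \<xi>) (at \<xi>)" by (simp add: field_differentiable_derivI)
  hence "((\<lambda>w. g w * (w - \<xi>)) has_field_derivative g \<xi>) (at \<xi>)"
    by (auto intro!: derivative_eq_intros)
  moreover have "\<forall>\<^sub>F w in nhds \<xi>. g w * (w - \<xi>) = f w"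
    using eventually_nhds_ball[OF s(1), of \<xi>] by eventually_elim (simp add: s(3))
  ultimately have "(f has_field_derivative g \<xi>) (at \<xi>)"
    by (subst (asm) DERIV_cong_ev) auto
  thus ?thesis using s(1) s(4)[of \<xi>] by (simp add: DERIV_imp_deriv)
qed

lemma zorder_mult_reflect:
  assumes f: "f holomorphic_on UNIV" "\<exists>z. f z \<noteq> 0" and u: "u holomorphic_on UNIV" "\<And>z. u z \<noteq> 0"
  shows "zorder (\<lambda>z. u z * f (- z)) (- \<xi>) = zorder f \<xi>"
proof -
  define n where "n = zorder f \<xi>"
  obtain g s where n: "n \<ge> 0" and s12: "s > 0" "g holomorphic_on cball \<xi> s" and
    factored: "\<forall>w\<in>cball \<xi> s. f w = g w * (w - \<xi>) ^ nat n \<and> g w \<noteq> 0"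
    by (rule zorder_factorization[OF f, of \<xi>, folded n_def], rule that)
  have s: "s > 0" "g holomorphic_on cball \<xi> s"
    "\<And>w. w \<in> cball \<xi> s \<Longrightarrow> f w = g w * (w - \<xi>) ^ nat n"
    "\<And>w. w \<in> cball \<xi> s \<Longrightarrow> g w \<noteq> 0"
    using s12 bspec[OF factored] by blast+
  have mem: "- w \<in> cball \<xi> s" if "w \<in> ball (- \<xi>) s" for w
    using that norm_minus_cancel[of "\<xi> + w"] by (simp add: dist_norm norm_minus_commute del: norm_minus_cancel)
  have "zorder (\<lambda>z. u z * f (- z)) (- \<xi>) = n"
  proof (rule zorder_eqI[where S = "ball (- \<xi>) s" and g = "\<lambda>w. u w * (-1) ^ nat n * g (- w)"])
    have "(\<lambda>w. g (- w)) holomorphic_on ball (- \<xi>) s"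
    proof (rule holomorphic_on_compose_gen[of uminus _ g "cball \<xi> s", unfolded o_def])
      show "uminus holomorphic_on ball (- \<xi>) s"
        using holomorphic_on_minus[OF holomorphic_on_ident] by simp
      show "g holomorphic_on cball \<xi> s" by (rule s(2))
      show "uminus ` ball (- \<xi>) s \<subseteq> cball \<xi> s" using mem by (rule image_subsetI)
    qed
    thus "(\<lambda>w. u w * (-1) ^ nat n * g (- w)) holomorphic_on ball (- \<xi>) s"
      using holomorphic_on_subset[OF u(1)] by (intro holomorphic_intros) auto
    show "u (- \<xi>) * (-1) ^ nat n * g (- (- \<xi>)) \<noteq> 0" using u(2) s(1) s(4)[of \<xi>] by simp
    fix w assume "w \<in> ball (- \<xi>) s"
    from s(3)[OF mem[OF this]] have "f (- w) = g (- w) * (- w - \<xi>) ^ nat n" .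
    also have "- w - \<xi> = (-1) * (w - - \<xi>)" by simp
    finally show "u w * f (- w) = u w * (-1) ^ nat n * g (- w) * (w - - \<xi>) powi n"
      using n by (simp only: power_mult_distrib power_int_def) simp
  qed (use s(1) in auto)
  thus ?thesis by (simp add: n_def)
qed

lemma holomorphic_reflect:
  assumes "f holomorphic_on UNIV"
  shows "(\<lambda>z. f (- z)) holomorphic_on UNIV"
proof -
  have "(\<lambda>z::complex. - z) holomorphic_on UNIV" by (intro holomorphic_on_minus holomorphic_on_ident)
  from holomorphic_on_compose_gen[OF this assms] show ?thesis by (simp add: o_def)
qed

section \<open>Functions with values in a slit plane are outer\<close>

text \<open>\<open>W\<close> has a square root \<open>g\<close> with nonnegative real part in the closed upper half-plane. For \<open>e > 0\<close> the
  function \<open>f / (g + e)\<^sup>2\<close> is bounded because \<open>norm (g + e) \<ge> e\<close>, and its modulus is at most \<open>1\<close> on the real line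
  because there \<open>norm f \<le> norm W = (norm g)\<^sup>2 \<le> (norm (g + e))\<^sup>2\<close>. By Phragmen and Lindelof \<open>norm f \<le> (norm (g + e))\<^sup>2\<close>, and \<open>e\<close> tends to \<open>0\<close>. In
  other words, such a \<open>W\<close> is an outer function.

  On the boundary \<open>W\<close> may take negative values, where the principal square root jumps. The sign hypothesis
  tells from which side they are approached: the right choice of branch depends only on the sign of \<open>t Re z\<close>.\<close>

lemma slit_plane_majorant:
  assumes W: "W holomorphic_on UNIV" and t: "t \<noteq> (0::real)"
    and sign: "\<And>z. Im z \<ge> 0 \<Longrightarrow> t * Re z * Im (W z) \<ge> 0"
    and axis: "\<And>y. y \<ge> 0 \<Longrightarrow> W (\<i> * of_real y) \<in> \<real>\<^sub>\<ge>\<^sub>0"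
    and slit: "\<And>z. Im z > 0 \<Longrightarrow> W z \<notin> \<real>\<^sub>\<le>\<^sub>0"
    and f: "f holomorphic_on UNIV" "\<And>z. Im z \<ge> 0 \<Longrightarrow> norm (f z) \<le> M"
    and real: "\<And>x. norm (f (of_real x)) \<le> norm (W (of_real x))"
    and z: "Im z \<ge> 0"
  shows "norm (f z) \<le> norm (W z)"
proof -
  define H where "H = {z. Im z \<ge> 0}"
  \<comment> \<open>\<open>a\<close> and \<open>b\<close> are the absolute values of the real and imaginary parts of both square roots of \<open>W z\<close>.\<close>
  define a b where "a z = sqrt ((norm (W z) + Re (W z)) / 2)" and "b z = sqrt ((norm (W z) - Re (W z)) / 2)" for z
  define g where "g z = of_real (a z) + \<i> * (if t * Re z \<ge> 0 then of_real (b z) else - of_real (b z))" for z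
  have contW: "continuous_on A W" for A
    using holomorphic_on_imp_continuous_on[OF holomorphic_on_subset[OF W]] by simp
  have ab: "a z \<ge> 0" "b z \<ge> 0" for z
    using abs_Re_le_cmod[of "W z"] by (auto simp: a_def b_def)
  have Reg: "Re (g z) = a z" and Img: "Im (g z) = (if t * Re z \<ge> 0 then b z else - b z)" for z
    by (auto simp: g_def)
  have normg: "(norm (g z))\<^sup>2 = norm (W z)" for z
  proof -
    have "(norm (g z))\<^sup>2 = (a z)\<^sup>2 + (b z)\<^sup>2" by (simp add: cmod_power2 Reg Img)
    also have "\<dots> = norm (W z)"
      using abs_Re_le_cmod[of "W z"] by (simp add: a_def b_def) (simp add: field_simps)
    finally show ?thesis .
  qed
  have contg: "continuous_on H g"
  proof -
    let ?P = "H \<inter> {z. t * Re z \<ge> 0}" and ?N = "H \<inter> {z. t * Re z \<le> 0}"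
    have cl: "closed H" unfolding H_def by (rule closed_halfspace_Im_ge)
    have "continuous_on (?P \<union> ?N) (\<lambda>z. if t * Re z \<ge> 0 then complex_of_real (b z) else - of_real (b z))"
    proof (rule continuous_on_cases)
      show "closed ?P" "closed ?N" using cl by (auto intro!: closed_Int closed_Collect_le continuous_intros)
      show "continuous_on ?P (\<lambda>z. complex_of_real (b z))" "continuous_on ?N (\<lambda>z. - complex_of_real (b z))"
        unfolding b_def by (intro continuous_intros contW; simp)+
      have "b z = 0" if "z \<in> H" "t * Re z = 0" for z
      proof -
        have "z = \<i> * of_real (Im z)" using that t by (auto simp: complex_eq_iff)
        hence "W z \<in> \<real>\<^sub>\<ge>\<^sub>0" using axis[of "Im z"] that(1) by (simp add: H_def)
        thus ?thesis by (auto simp: b_def complex_nonneg_Reals_iff cmod_eq_Re)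
      qed
      thus "\<forall>z. (z \<in> ?P \<and> \<not> t * Re z \<ge> 0) \<or> (z \<in> ?N \<and> t * Re z \<ge> 0) \<longrightarrow> complex_of_real (b z) = - of_real (b z)"
        by auto
    qed
    moreover have "?P \<union> ?N = H" by auto
    ultimately show ?thesis unfolding g_def a_def by (auto intro!: continuous_intros contW)
  qed
  have g_csqrt: "g z = csqrt (W z)" if z: "Im z > 0" for z
  proof -
    have nonreal_axis: "Im (W z) = 0" if "Re z = 0"
    proof -
      have "z = \<i> * of_real (Im z)" using that by (auto simp: complex_eq_iff)
      thus ?thesis using axis[of "Im z"] z by (auto simp: complex_nonneg_Reals_iff)
    qed
    consider "Im (W z) = 0" | "Im (W z) > 0" | "Im (W z) < 0" by linarith
    thus ?thesis
    proof cases
      case 1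
      hence "Re (W z) > 0" using slit[OF z] by (auto simp: complex_nonpos_Reals_iff)
      thus ?thesis using 1 by (auto simp: complex_eq_iff Reg Img a_def b_def cmod_eq_Re)
    next
      case 2
      hence "t * Re z \<ge> 0" using sign[of z] z by (simp add: zero_le_mult_iff)
      thus ?thesis using 2 by (simp add: complex_eq_iff Reg Img a_def b_def)
    next
      case 3
      hence "t * Re z \<le> 0" using sign[of z] z by (simp add: zero_le_mult_iff)
      moreover have "t * Re z \<noteq> 0" using nonreal_axis 3 t by auto
      ultimately show ?thesis using 3 by (simp add: complex_eq_iff Reg Img a_def b_def)
    qed
  qed
  have inner: "{z. Im z > 0} = interior H"
  proof -
    have "H = {z. z \<bullet> \<i> \<ge> 0}" by (auto simp: H_def)
    hence "interior H = {z. \<i> \<bullet> z > 0}" using interior_halfspace_ge[of \<i> 0] by (simp add: inner_commute)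
    thus ?thesis by auto
  qed
  have holg: "g holomorphic_on interior H"
  proof -
    have "(\<lambda>z. csqrt (W z)) holomorphic_on {z. Im z > 0}"
      using slit holomorphic_on_subset[OF W] by (intro holomorphic_on_csqrt') auto
    thus ?thesis unfolding inner[symmetric] using g_csqrt by (subst holomorphic_cong[OF refl]) auto
  qed
  have bound: "norm (f z) \<le> (norm (g z + of_real e))\<^sup>2" if e: "e > 0" for e
  proof -
    have lower: "norm (g w + of_real e) \<ge> e" "norm (g w + of_real e) \<ge> norm (g w)" for w
    proof -
      show "norm (g w + of_real e) \<ge> e"
        using complex_Re_le_cmod[of "g w + of_real e"] ab[of w] by (simp add: Reg)
      have "(Re (g w))\<^sup>2 \<le> (Re (g w) + e)\<^sup>2" using ab[of w] e by (intro power_mono) (auto simp: Reg)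
      thus "norm (g w + of_real e) \<ge> norm (g w)" by (simp add: cmod_def)
    qed
    have ne: "g w + of_real e \<noteq> 0" for w using lower(1)[of w] e by auto
    have "norm (f z / (g z + of_real e)\<^sup>2) \<le> 1"
    proof (rule Phragmen_Lindelof_bounded[where S = H and f = "\<lambda>w. f w / (g w + of_real e)\<^sup>2"])
      show "closed H" unfolding H_def by (rule closed_halfspace_Im_ge)
      show "H \<subseteq> {z. Im z \<ge> 0}" "z \<in> H" using z by (auto simp: H_def)
      show "continuous_on H (\<lambda>w. f w / (g w + of_real e)\<^sup>2)"
        using ne holomorphic_on_imp_continuous_on[OF holomorphic_on_subset[OF f(1)]]
        by (intro continuous_intros contg) auto
      show "(\<lambda>w. f w / (g w + of_real e)\<^sup>2) holomorphic_on interior H"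
        using ne holomorphic_on_subset[OF f(1)] by (intro holomorphic_intros holg) auto
      show "norm (f w / (g w + of_real e)\<^sup>2) \<le> M / e\<^sup>2" if "w \<in> H" for w
      proof -
        have "norm (f w) \<le> M" using f(2)[of w] that by (simp add: H_def)
        moreover have "e\<^sup>2 \<le> (norm (g w + of_real e))\<^sup>2" using lower(1)[of w] e by (intro power_mono) auto
        ultimately show ?thesis using e order_trans[OF norm_ge_zero, of "f w" M]
          unfolding norm_divide norm_power by (intro frac_le) auto
      qed
      show "norm (f w / (g w + of_real e)\<^sup>2) \<le> 1" if "w \<in> frontier H" for w
      proof -
        have "w \<in> H" "w \<notin> interior H"
          using that closed_halfspace_Im_ge[of 0] by (auto simp: frontier_def H_def)
        hence "Im w = 0" unfolding inner[symmetric] by (auto simp: H_def)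
        hence "w = of_real (Re w)" by (auto simp: complex_eq_iff)
        hence "norm (f w) \<le> norm (W w)" using real by metis
        also have "\<dots> \<le> (norm (g w + of_real e))\<^sup>2"
          unfolding normg[symmetric] using lower(2)[of w] by (intro power_mono) auto
        finally show ?thesis using ne[of w] by (simp add: norm_divide norm_power divide_simps)
      qed
    qed
    thus ?thesis using ne[of z] by (simp add: norm_divide norm_power divide_simps)
  qed
  have "((\<lambda>e. (norm (g z + of_real e))\<^sup>2) \<longlongrightarrow> (norm (g z + of_real 0))\<^sup>2) (at_right 0)"
    by (intro tendsto_intros)
  moreover have "\<forall>\<^sub>F e in at_right 0. norm (f z) \<le> (norm (g z + of_real e))\<^sup>2"
    using bound by (intro eventually_at_rightI[of 0 1]) auto
  ultimately have "norm (f z) \<le> (norm (g z + of_real 0))\<^sup>2"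
    by (intro tendsto_lowerbound) auto
  thus ?thesis by (simp add: normg)
qed

section \<open>Zeros of functions with nonnegative imaginary part in a quadrant\<close>

text \<open>The properties of \<open>K z = exp (\<i> \<sigma> z) F(-z)\<close> on which the distribution of zeros rests. The symmetry
  says that \<open>K\<close> is real on the imaginary axis, and it reflects the first quadrant to the second.\<close>

locale quadrant_positive =
  fixes K :: "complex \<Rightarrow> complex" and M :: real
  assumes hol: "K holomorphic_on UNIV"
    and bound: "\<And>z. Im z \<ge> 0 \<Longrightarrow> norm (K z) \<le> M"
    and sym: "\<And>z. K (- cnj z) = cnj (K z)"
    and pos: "\<And>x. x \<ge> 0 \<Longrightarrow> Im (K (of_real x)) \<ge> 0"
begin

lemma real_on_axis: "Im (K (\<i> * of_real y)) = 0"
proof -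
  have "K (\<i> * of_real y) = cnj (K (\<i> * of_real y))" using sym[of "\<i> * of_real y"] by simp
  thus ?thesis by (metis add.inverse_neutral complex_cnj_cancel_iff complex_eq_iff cnj.sel(2) neg_equal_zero)
qed

text \<open>The modulus of \<open>exp (\<i> K)\<close> is \<open>exp (- Im K)\<close>. It is bounded in the quadrant, equal to \<open>1\<close> on the imaginary axis and
  at most \<open>1\<close> on the positive real axis.\<close>

lemma Im_nonneg:
  assumes "Re z \<ge> 0" "Im z \<ge> 0"
  shows "Im (K z) \<ge> 0"
proof -
  define Q where "Q = {z. Re z \<ge> 0} \<inter> {z. Im z \<ge> 0}"
  have cl: "closed Q" unfolding Q_def by (intro closed_Int closed_halfspace_Re_ge closed_halfspace_Im_ge)
  have "norm (exp (\<i> * K z)) \<le> 1"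
  proof (rule Phragmen_Lindelof_bounded[where S = Q and f = "\<lambda>z. exp (\<i> * K z)"])
    show "Q \<subseteq> {z. Im z \<ge> 0}" "z \<in> Q" using assms by (auto simp: Q_def)
    show "continuous_on Q (\<lambda>z. exp (\<i> * K z))"
      using holomorphic_on_imp_continuous_on[OF holomorphic_on_subset[OF hol]] by (intro continuous_intros) auto
    show "(\<lambda>z. exp (\<i> * K z)) holomorphic_on interior Q"
      using holomorphic_on_subset[OF hol] by (intro holomorphic_intros) auto
    show "norm (exp (\<i> * K w)) \<le> exp M" if "w \<in> Q" for w
      using that bound[of w] abs_Im_le_cmod[of "K w"] by (auto simp: Q_def)
    show "norm (exp (\<i> * K w)) \<le> 1" if w: "w \<in> frontier Q" for w
    proof -
      have "{z. Re z > 0} \<inter> {z. Im z > 0} \<subseteq> interior Q"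
        by (intro interior_maximal open_Int open_halfspace_Re_gt open_halfspace_Im_gt) (auto simp: Q_def)
      moreover have wQ: "w \<in> Q" "w \<notin> interior Q" using w cl by (auto simp: frontier_def)
      ultimately have "\<not> (Re w > 0 \<and> Im w > 0)" by blast
      moreover have "Re w \<ge> 0" "Im w \<ge> 0" using wQ(1) by (auto simp: Q_def)
      ultimately have "Re w \<ge> 0" "Re w = 0 \<or> Im w = 0" by auto
      hence "w = \<i> * of_real (Im w) \<or> w = of_real (Re w) \<and> Re w \<ge> 0" by (auto simp: complex_eq_iff)
      hence "Im (K w) \<ge> 0" using real_on_axis[of "Im w"] pos[of "Re w"] by fastforce
      thus ?thesis by simp
    qed
  qed (use cl in auto)
  thus ?thesis by simp
qed

lemma Im_sign:
  assumes "Im z \<ge> 0"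
  shows "Re z * Im (K z) \<ge> 0"
proof (cases "Re z \<ge> 0")
  case True
  thus ?thesis using Im_nonneg assms by simp
next
  case False
  have "Im (K (- cnj z)) \<ge> 0" using False assms by (intro Im_nonneg) auto
  hence "Im (K z) \<le> 0" by (simp add: sym)
  thus ?thesis using False by (simp add: mult_nonpos_nonpos)
qed

text \<open>Near a nonzero real point, a half-disc in the upper half-plane lies in one quadrant.\<close>

lemma zorder_real_nonzero:
  assumes "\<exists>z. K z \<noteq> 0" "x \<noteq> 0"
  shows "zorder K (of_real x) \<le> 1"
proof -
  have "of_int (zorder K (of_real x)) * (pi - 0) \<le> pi"
  proof (rule zorder_sector_bound[OF hol assms(1), of "of_real x" "\<bar>x\<bar>"])
    fix \<rho> \<theta> :: real assume *: "0 < \<rho>" "\<rho> < \<bar>x\<bar>" "0 < \<theta>" "\<theta> < pi"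
    let ?z = "of_real x + of_real \<rho> * cis \<theta>"
    have "Im ?z > 0" using * sin_gt_zero[of \<theta>] by simp
    hence s: "Re ?z * Im (K ?z) \<ge> 0" by (intro Im_sign) simp
    have "\<bar>\<rho> * cos \<theta>\<bar> \<le> \<rho>" using * by (simp add: abs_mult mult_left_le)
    hence "x * Re ?z > 0" using * assms(2) by (cases "x > 0") (auto simp: zero_less_mult_iff)
    hence "x * Im (K ?z) \<ge> 0" using s by (auto simp: zero_less_mult_iff zero_le_mult_iff)
    thus "Im (of_real x * K ?z) \<ge> 0" by simp
  qed (use assms in auto)
  thus ?thesis by simp
qed

text \<open>At the origin only a quarter-disc of constant sign is available, hence the larger bound.\<close>

lemma zorder_0:
  assumes "\<exists>z. K z \<noteq> 0"
  shows "zorder K 0 \<le> 2"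
proof -
  have "of_int (zorder K 0) * (pi / 2 - 0) \<le> pi"
  proof (rule zorder_sector_bound[OF hol assms, of 1 1])
    fix \<rho> \<theta> :: real assume *: "0 < \<rho>" "\<rho> < 1" "0 < \<theta>" "\<theta> < pi / 2"
    thus "Im (1 * K (0 + of_real \<rho> * cis \<theta>)) \<ge> 0"
      using sin_gt_zero[of \<theta>] cos_gt_zero[of \<theta>] by (simp add: Im_nonneg)
  qed auto
  thus ?thesis by simp
qed

text \<open>If \<open>K \<xi>\<close> were real, the imaginary part of \<open>K - K \<xi>\<close> would have constant sign in a full disc around its zero \<open>\<xi>\<close>.\<close>

lemma nonreal_off_axis:
  assumes nc: "\<exists>z. K z \<noteq> K \<xi>" and \<xi>: "Im \<xi> > 0" "Re \<xi> \<noteq> 0"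
  shows "Im (K \<xi>) \<noteq> 0"
proof
  assume real: "Im (K \<xi>) = 0"
  define f where "f z = K z - K \<xi>" for z
  have f: "f holomorphic_on UNIV" "\<exists>z. f z \<noteq> 0" "f \<xi> = 0"
    using hol nc by (auto simp: f_def[abs_def] intro!: holomorphic_intros)
  have "of_int (zorder f \<xi>) * (2 * pi - 0) \<le> pi"
  proof (rule zorder_sector_bound[OF f(1,2), of "of_real (Re \<xi>)" "min (Im \<xi>) \<bar>Re \<xi>\<bar>"])
    fix \<rho> \<theta> :: real assume *: "0 < \<rho>" "\<rho> < min (Im \<xi>) \<bar>Re \<xi>\<bar>"
    let ?z = "\<xi> + of_real \<rho> * cis \<theta>"
    have "\<bar>\<rho> * sin \<theta>\<bar> \<le> \<rho>" "\<bar>\<rho> * cos \<theta>\<bar> \<le> \<rho>" using * by (simp_all add: abs_mult mult_left_le)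
    hence "Im ?z > 0" and c: "\<bar>\<rho> * cos \<theta>\<bar> < \<bar>Re \<xi>\<bar>" using * by auto
    hence s: "Re ?z * Im (K ?z) \<ge> 0" by (intro Im_sign) simp
    have "Re \<xi> * Re ?z > 0" using c \<xi> by (cases "Re \<xi> > 0") (auto simp: zero_less_mult_iff)
    hence "Re \<xi> * Im (K ?z) \<ge> 0" using s by (auto simp: zero_less_mult_iff zero_le_mult_iff)
    thus "Im (of_real (Re \<xi>) * f ?z) \<ge> 0" using real by (simp add: f_def)
  qed (use \<xi> in auto)
  moreover have "zorder f \<xi> \<ge> 1" using zorder_pos_at_zero[OF f] .
  ultimately have "1 * (2 * pi) \<le> pi" 
    using mult_right_mono[of 1 "of_int (zorder f \<xi>)" "2 * pi"] by simp
  thus False using pi_gt_zero by simp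
qed

text \<open>To the right of \<open>\<i> y\<close> there is a half-disc contained in the first quadrant.\<close>

lemma order_on_axis:
  assumes nc: "\<exists>z. K z \<noteq> K (\<i> * of_real y)" and y: "y > 0"
  shows "zorder (\<lambda>z. K z - K (\<i> * of_real y)) (\<i> * of_real y) = 1"
proof -
  define \<xi> where "\<xi> = \<i> * complex_of_real y"
  define f where "f z = K z - K \<xi>" for z
  have f: "f holomorphic_on UNIV" "\<exists>z. f z \<noteq> 0" "f \<xi> = 0"
    using hol nc by (auto simp: f_def[abs_def] \<xi>_def intro!: holomorphic_intros)
  have "of_int (zorder f \<xi>) * (pi / 2 - (- (pi / 2))) \<le> pi"
  proof (rule zorder_sector_bound[OF f(1,2), of 1 y])
    fix \<rho> \<theta> :: real assume *: "0 < \<rho>" "\<rho> < y" "- (pi / 2) < \<theta>" "\<theta> < pi / 2"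
    have "\<bar>\<rho> * sin \<theta>\<bar> \<le> \<rho>" using * by (simp_all add: abs_mult mult_left_le)
    moreover have "cos \<theta> > 0" using * by (intro cos_gt_zero_pi) auto
    ultimately show "Im (1 * f (\<xi> + of_real \<rho> * cis \<theta>)) \<ge> 0"
      using * real_on_axis[of y] by (auto simp: f_def \<xi>_def intro!: Im_nonneg)
  qed (use y in auto)
  moreover have "zorder f \<xi> \<ge> 1" using zorder_pos_at_zero[OF f] .
  ultimately show ?thesis by (simp add: f_def[abs_def] \<xi>_def)
qed

definition axis_value :: "real \<Rightarrow> real" where "axis_value y = Re (K (\<i> * of_real y))"

lemma K_axis: "K (\<i> * of_real y) = of_real (axis_value y)"
  by (simp add: axis_value_def complex_eq_iff real_on_axis)

lemma K_along_line: "((\<lambda>s. K (a + of_real s * v)) has_vector_derivative v * deriv K (a + of_real s * v)) (at s)"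
proof -
  have "((\<lambda>s. a + of_real s * v) has_vector_derivative v) (at s)"
    by (auto intro!: derivative_eq_intros)
  moreover have "(K has_field_derivative deriv K (a + of_real s * v)) (at (a + of_real s * v))"
    using holomorphic_derivI[OF hol] by simp
  ultimately show ?thesis
    using field_vector_diff_chain_at[of "\<lambda>s. a + of_real s * v" v s K] by (simp add: o_def)
qed

lemma axis_value_deriv: "(axis_value has_real_derivative - Im (deriv K (\<i> * of_real y))) (at y)"
proof -
  have "((\<lambda>y. K (\<i> * of_real y)) has_vector_derivative \<i> * deriv K (\<i> * of_real y)) (at y)"
    using K_along_line[of 0 \<i> y] by (simp add: mult.commute)
  hence "((\<lambda>y. Re (K (\<i> * of_real y))) has_vector_derivative Re (\<i> * deriv K (\<i> * of_real y))) (at y)"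
    by (rule bounded_linear.has_vector_derivative[OF bounded_linear_Re])
  thus ?thesis by (simp add: axis_value_def[abs_def] has_real_derivative_iff_has_vector_derivative)
qed

lemma Re_deriv_axis: "Re (deriv K (\<i> * of_real y)) = 0"
proof -
  have "((\<lambda>y. K (\<i> * of_real y)) has_vector_derivative \<i> * deriv K (\<i> * of_real y)) (at y)"
    using K_along_line[of 0 \<i> y] by (simp add: mult.commute)
  hence "((\<lambda>y. Im (K (\<i> * of_real y))) has_vector_derivative Im (\<i> * deriv K (\<i> * of_real y))) (at y)"
    by (rule bounded_linear.has_vector_derivative[OF bounded_linear_Im])
  hence "((\<lambda>y. 0) has_real_derivative Re (deriv K (\<i> * of_real y))) (at y)"
    by (simp add: real_on_axis has_real_derivative_iff_has_vector_derivative)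
  thus ?thesis using DERIV_unique DERIV_const by blast
qed

text \<open>\<open>Im K\<close> vanishes on the imaginary axis and is nonnegative to the right of it, so its horizontal derivative,
  \<open>Im (deriv K)\<close>, is nonnegative there. By the Cauchy-Riemann equations this is minus the derivative of \<open>K\<close> along
  the axis.\<close>

lemma Im_deriv_axis_nonneg:
  assumes "y \<ge> 0"
  shows "Im (deriv K (\<i> * of_real y)) \<ge> 0"
proof -
  let ?\<xi> = "\<i> * complex_of_real y"
  have "((\<lambda>x. K (?\<xi> + of_real x)) has_vector_derivative deriv K ?\<xi>) (at 0)"
    using K_along_line[of ?\<xi> 1 0] by simp
  hence "((\<lambda>x. Im (K (?\<xi> + of_real x))) has_vector_derivative Im (deriv K ?\<xi>)) (at 0)"
    by (rule bounded_linear.has_vector_derivative[OF bounded_linear_Im])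
  hence D: "((\<lambda>x. Im (K (?\<xi> + of_real x))) has_real_derivative Im (deriv K ?\<xi>)) (at 0)"
    by (simp add: has_real_derivative_iff_has_vector_derivative)
  show ?thesis
  proof (rule ccontr)
    assume "\<not> ?thesis"
    then obtain d where d: "d > 0" "\<And>h. 0 < h \<Longrightarrow> h < d \<Longrightarrow> Im (K (?\<xi> + of_real (0 + h))) < Im (K (?\<xi> + of_real 0))"
      using DERIV_neg_dec_right[OF D] by auto
    have "Im (K (?\<xi> + of_real (0 + d / 2))) < 0" using d(2)[of "d / 2"] d(1) real_on_axis[of y] by simp
    moreover have "Im (K (?\<xi> + of_real (0 + d / 2))) \<ge> 0" using d(1) assms by (intro Im_nonneg) auto
    ultimately show False by simp
  qed
qed

lemma axis_value_antimono:
  assumes "0 \<le> a" "a \<le> b"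
  shows "axis_value b \<le> axis_value a"
  using assms Im_deriv_axis_nonneg axis_value_deriv
  by (intro DERIV_nonpos_imp_nonincreasing[OF assms(2)]) force

text \<open>At a critical point of \<open>axis_value\<close> the complex
  derivative of \<open>K\<close> would vanish, against the fact that every value on the axis is attained to order one.\<close>

lemma axis_value_strict_antimono:
  assumes nc: "\<And>\<xi>. \<exists>z. K z \<noteq> K \<xi>" and ab: "0 \<le> a" "a < b"
  shows "axis_value b < axis_value a"
proof -
  have "\<exists>D. (axis_value has_real_derivative D) (at y) \<and> D < 0" if y: "a < y" for y
  proof -
    have y: "y > 0" using y ab by simp
    let ?\<xi> = "\<i> * complex_of_real y"
    have "deriv (\<lambda>z. K z - K ?\<xi>) ?\<xi> \<noteq> 0"
      using hol nc[of ?\<xi>] by (intro deriv_nonzero_if_zorder_1 order_on_axis y holomorphic_intros) auto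
    also have "deriv (\<lambda>z. K z - K ?\<xi>) ?\<xi> = deriv K ?\<xi>"
      using holomorphic_on_imp_differentiable_at[OF hol] by (subst deriv_diff) auto
    finally have "Im (deriv K ?\<xi>) \<noteq> 0" using Re_deriv_axis[of y] by (auto simp: complex_eq_iff)
    thus ?thesis using axis_value_deriv[of y] Im_deriv_axis_nonneg[of y] y by force
  qed
  moreover have "continuous_on {a..b} axis_value"
    using axis_value_deriv by (intro DERIV_continuous_on) (blast intro: has_field_derivative_at_within)
  ultimately show ?thesis
    using DERIV_neg_imp_decreasing_open[OF ab(2), of axis_value] by blast
qed

lemma upper_zero_on_axis:
  assumes "\<exists>z. K z \<noteq> 0" "Im \<xi> > 0" "K \<xi> = 0"
  shows "Re \<xi> = 0" "\<And>w. \<exists>z. K z \<noteq> K w"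
proof -
  show "\<exists>z. K z \<noteq> K w" for w using assms by metis
  show "Re \<xi> = 0" using nonreal_off_axis[of \<xi>] assms by auto
qed

text \<open>If \<open>K\<close> has no zero in the upper half-plane, then one of \<open>K\<close>, \<open>- K\<close> maps it to the plane slit along the
  nonpositive real axis; \<open>t\<close> records which.\<close>

lemma outer_majorant:
  assumes t: "t \<in> {1, -1::real}"
    and ax: "\<And>y. y \<ge> 0 \<Longrightarrow> t * axis_value y \<ge> 0"
    and nz: "\<And>z. Im z > 0 \<Longrightarrow> K z \<noteq> 0"
    and f: "f holomorphic_on UNIV" "\<And>z. Im z \<ge> 0 \<Longrightarrow> norm (f z) \<le> B"
    and real: "\<And>x. norm (f (of_real x)) \<le> norm (K (of_real x))"
    and z: "Im z \<ge> 0"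
  shows "norm (f z) \<le> norm (K z)"
proof -
  have ntK: "norm (of_real t * K z) = norm (K z)" for z using t by (auto simp: norm_mult)
  have axis: "of_real t * K (\<i> * of_real y) \<in> \<real>\<^sub>\<ge>\<^sub>0" if "y \<ge> 0" for y
    using ax[OF that] by (simp add: K_axis complex_nonneg_Reals_iff)
  have "norm (f z) \<le> norm (of_real t * K z)"
  proof (rule slit_plane_majorant[where W = "\<lambda>z. of_real t * K z" and t = t and M = B])
    show "(\<lambda>z. of_real t * K z) holomorphic_on UNIV" using hol by (intro holomorphic_intros)
    show "t \<noteq> 0" using t by auto
    show "t * Re z * Im (of_real t * K z) \<ge> 0" if "Im z \<ge> 0" for z
      using Im_sign[OF that] t by auto
    show "of_real t * K z \<notin> \<real>\<^sub>\<le>\<^sub>0" if z: "Im z > 0" for z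
    proof
      assume np: "of_real t * K z \<in> \<real>\<^sub>\<le>\<^sub>0"
      hence "Im (K z) = 0" using t by (auto simp: complex_nonpos_Reals_iff)
      \<comment> \<open>In either case the value is also taken on the imaginary axis, where its sign is known.\<close>
      hence "Re z = 0 \<or> (\<forall>w. K w = K z)" using nonreal_off_axis[of z] z by blast
      hence "K z = K (\<i> * of_real (Im z))"
      proof
        assume "Re z = 0"
        hence "z = \<i> * of_real (Im z)" by (simp add: complex_eq_iff)
        thus ?thesis by simp
      next
        assume "\<forall>w. K w = K z"
        thus ?thesis by metis
      qed
      hence "of_real t * K z \<in> \<real>\<^sub>\<ge>\<^sub>0" using axis[of "Im z"] z by simp
      hence "of_real t * K z = 0" using np
        by (auto simp: complex_nonpos_Reals_iff complex_nonneg_Reals_iff complex_eq_iff)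
      thus False using nz[OF z] t by auto
    qed
    show "of_real t * K (\<i> * of_real y) \<in> \<real>\<^sub>\<ge>\<^sub>0" if "y \<ge> 0" for y using axis[OF that] .
    show "norm (f (of_real x)) \<le> norm (of_real t * K (of_real x))" for x using real ntK by simp
  qed (use f z in auto)
  thus ?thesis by (simp add: ntK)
qed

end

section \<open>Zeros of the Fourier-Stieltjes transform\<close>

text \<open>If \<open>F = c h\<close> with \<open>h\<close> real on the real axis, then \<open>cnj c * F z\<close> and \<open>c * F (- z)\<close> agree for real \<open>z\<close>, hence everywhere.\<close>

lemma trivial_HB_norm_reflect:
  assumes F: "F holomorphic_on UNIV" "\<And>z. F (- cnj z) = cnj (F z)" and triv: "trivial_HB F"
  shows "norm (F z) = norm (F (- z))"
proof -
  obtain c h where h: "\<And>x::real. h (of_real x) \<in> \<real>" and Fh: "F = (\<lambda>z. c * h z)"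
    using triv unfolding trivial_HB_def by blast
  show ?thesis
  proof (cases "c = 0")
    case False
    have zero: "(0::complex) islimpt \<real>"
    proof (unfold islimpt_approachable, intro allI impI)
      fix e :: real assume "e > 0"
      thus "\<exists>x'\<in>\<real>. x' \<noteq> (0::complex) \<and> dist x' 0 < e"
        by (intro bexI[of _ "of_real (e / 2)"]) auto
    qed
    have on_reals: "cnj c * F x - c * F (- x) = 0" if xr: "x \<in> \<real>" for x
    proof -
      obtain r where x: "x = of_real r" using xr by (rule Reals_cases)
      have "F (- x) = cnj (F x)" using F(2)[of x] unfolding x by simp
      also have "F x = c * h x" unfolding Fh ..
      also have "cnj (c * h x) = cnj c * h x" using h[of r] unfolding x by (simp add: Reals_cnj_iff)
      finally have "F (- x) = cnj c * h x" .
      moreover have "F x = c * h x" unfolding Fh ..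
      ultimately show ?thesis by simp
    qed
    have "(\<lambda>z. F (- z)) holomorphic_on UNIV"
      using F(1) by (rule holomorphic_reflect)
    hence "(\<lambda>z. cnj c * F z - c * F (- z)) holomorphic_on UNIV"
      by (intro holomorphic_on_diff holomorphic_on_mult holomorphic_on_const F(1))
    from analytic_continuation[OF this open_UNIV connected_UNIV subset_UNIV UNIV_I zero on_reals UNIV_I]
    have "cnj c * F z - c * F (- z) = 0" .
    hence "norm (cnj c * F z) = norm (c * F (- z))" by simp
    thus ?thesis using False by (simp add: norm_mult)
  qed (unfold Fh, simp)
qed

text \<open>On the real axis the imaginary part of \<open>exp (\<i> \<sigma> x) F(-x)\<close> is exactly \<open>S x\<close>.\<close>

lemma reflected_fourier_stieltjes_quadrant_positive:
  assumes \<sigma>: "\<sigma> > 0" and V: "variation_majorant V \<mu> 0 \<sigma>"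
    and S: "\<And>x::real. x > 0 \<Longrightarrow>
      - stieltjes_integral 0 \<sigma> (\<lambda>t. sin (of_real x * complex_of_real t)) (\<lambda>t. \<mu> (\<sigma> - t)) \<in> \<real>\<^sub>\<ge>\<^sub>0"
  shows "quadrant_positive (\<lambda>z. exp (\<i> * \<sigma> * z) * fourier_stieltjes \<sigma> \<mu> (- z)) (V \<sigma> - V 0)"
proof
  let ?F = "fourier_stieltjes \<sigma> \<mu>"
  let ?K = "\<lambda>z. exp (\<i> * \<sigma> * z) * ?F (- z)"
  have "(\<lambda>z. ?F (- z)) holomorphic_on UNIV"
    by (intro holomorphic_reflect fourier_stieltjes_holomorphic[OF \<sigma> V])
  thus "?K holomorphic_on UNIV" by (intro holomorphic_intros)
  show "norm (?K z) \<le> V \<sigma> - V 0" if "Im z \<ge> 0" for z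
    using fourier_stieltjes_reflected_norm_le[OF \<sigma> V that] .
  show sym: "?K (- cnj z) = cnj (?K z)" for z
    using fourier_stieltjes_cnj[OF \<sigma> V, of "- z"] by (simp add: exp_cnj)
  show "Im (?K (of_real x)) \<ge> 0" if "x \<ge> 0" for x
  proof (cases "x = 0")
    case True
    thus ?thesis by (simp add: fourier_stieltjes_0[OF \<sigma> V])
  next
    case False
    define s where "s = - stieltjes_integral 0 \<sigma> (\<lambda>t. sin (of_real x * complex_of_real t)) (\<lambda>t. \<mu> (\<sigma> - t))"
    have "?K (- of_real x) = cnj (?K (of_real x))" using sym[of "of_real x"] by simp
    hence diff: "?K (of_real x) - cnj (?K (of_real x)) = 2 * \<i> * s"
      using sine_stieltjes_eq[OF \<sigma> V, of "of_real x"] by (simp add: s_def algebra_simps)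
    have half: "Im k = Re s" if "k - cnj k = 2 * \<i> * s" for k
      using that by (auto simp: complex_eq_iff)
    have "Im (?K (of_real x)) = Re s" by (rule half[OF diff])
    moreover have "s \<in> \<real>\<^sub>\<ge>\<^sub>0" unfolding s_def using S[of x] that False by simp
    ultimately show ?thesis by (simp add: complex_nonneg_Reals_iff)
  qed
qed

theorem theorem1p4:
  fixes \<sigma> :: real and \<mu> :: "real \<Rightarrow> real" and F S :: "complex \<Rightarrow> complex" and m :: real
  defines "F \<equiv> \<lambda>z. stieltjes_integral 0 \<sigma> (\<lambda>t. exp (\<i> * z * complex_of_real t)) \<mu>"
    and "S \<equiv> \<lambda>z. - stieltjes_integral 0 \<sigma> (\<lambda>t. sin (z * complex_of_real t)) (\<lambda>t. \<mu> (\<sigma> - t))"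
    and "m \<equiv> Lim (at_left \<sigma>) \<mu>"
  assumes "\<sigma> > 0"
    and "bounded_variation_on \<mu> 0 \<sigma>"
    and "\<forall>x::real. x > 0 \<longrightarrow> S (complex_of_real x) \<in> \<real>\<^sub>\<ge>\<^sub>0"
    and "\<exists>z. F z \<noteq> 0"
  shows "(\<forall>x::real. x \<noteq> 0 \<and> F (complex_of_real x) = 0 \<longrightarrow> zorder F (complex_of_real x) = 1) \<and>
    (F 0 = 0 \<longrightarrow> zorder F 0 \<le> 2) \<and>
    m \<ge> \<mu> 0 \<and>
    (F 0 \<in> complex_of_real ` ({..0} \<union> {m - \<mu> 0..}) \<longrightarrow> F \<in> HB_bar \<and> \<not> trivial_HB F) \<and>
    (F 0 \<in> complex_of_real ` {0<..<m - \<mu> 0} \<longrightarrow>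
      (\<exists>z0. {z. Im z < 0 \<and> F z = 0} = {z0} \<and> zorder F z0 = 1 \<and> Re z0 = 0))"
proof -
  note \<sigma> = assms(4) and F_nz = assms(7)
  obtain V where V: "variation_majorant V \<mu> 0 \<sigma>"
    using variation_majorant_exists[OF assms(5)] .
  have F_eq: "F = fourier_stieltjes \<sigma> \<mu>" by (simp add: F_def fourier_stieltjes_def fun_eq_iff)
  define K where "K z = exp (\<i> * \<sigma> * z) * F (- z)" for z
  interpret quadrant_positive K "V \<sigma> - V 0"
    using reflected_fourier_stieltjes_quadrant_positive[OF \<sigma> V] assms(6)
    unfolding K_def[abs_def] F_eq S_def by blast
  have holF: "F holomorphic_on UNIV" unfolding F_eq by (rule fourier_stieltjes_holomorphic[OF \<sigma> V])
  have F_cnj: "F (- cnj z) = cnj (F z)" for z unfolding F_eq by (rule fourier_stieltjes_cnj[OF \<sigma> V])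
  have K_nz: "\<exists>z. K z \<noteq> 0"
  proof -
    obtain w where "F w \<noteq> 0" using F_nz by blast
    hence "K (- w) \<noteq> 0" by (simp add: K_def)
    thus ?thesis ..
  qed
  have K_zero: "K z = 0 \<longleftrightarrow> F (- z) = 0" for z by (simp add: K_def)
  have zorder_K: "zorder K (- z) = zorder F z" for z
    unfolding K_def[abs_def] by (rule zorder_mult_reflect[OF holF F_nz]) (auto intro!: holomorphic_intros)

  have F0: "F 0 = of_real (\<mu> \<sigma> - \<mu> 0)" unfolding F_eq by (rule fourier_stieltjes_0[OF \<sigma> V])
  hence h0: "axis_value 0 = \<mu> \<sigma> - \<mu> 0" by (simp add: axis_value_def K_def)
  have h_lim: "(axis_value \<longlongrightarrow> \<mu> \<sigma> - m) at_top"
    using tendsto_Re[OF fourier_stieltjes_reflected_limit[OF \<sigma> V]]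
    by (simp add: axis_value_def[abs_def] K_def F_eq m_def)
  have h_ge: "axis_value y \<ge> \<mu> \<sigma> - m" if "y \<ge> 0" for y
  proof (rule tendsto_upperbound[OF h_lim])
    show "\<forall>\<^sub>F x in at_top. axis_value x \<le> axis_value y"
      using eventually_ge_at_top[of y] by eventually_elim (rule axis_value_antimono[OF that])
  qed simp
  \<comment> \<open>The inequality with the limit is strict since there is still room to decrease beyond \<open>y\<close>.\<close>
  have h_gt: "axis_value y > \<mu> \<sigma> - m" if "y \<ge> 0" "\<And>\<xi>. \<exists>z. K z \<noteq> K \<xi>" for y
    using axis_value_strict_antimono[OF that(2,1), of "y + 1"] h_ge[of "y + 1"] that(1) by simp

  have real_zeros: "zorder F (of_real x) = 1" if "x \<noteq> 0" "F (of_real x) = 0" for x :: real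
    using zorder_real_nonzero[OF K_nz, of "- x"] zorder_pos_at_zero[OF holF F_nz that(2)] that(1)
      zorder_K[of "of_real x"] by simp
  have zero_order: "zorder F 0 \<le> 2" using zorder_0[OF K_nz] zorder_K[of 0] by simp
  have m: "m \<ge> \<mu> 0" using h_ge[of 0] h0 by simp

  have case1: "F \<in> HB_bar \<and> \<not> trivial_HB F" if c: "\<mu> \<sigma> - \<mu> 0 \<le> 0 \<or> \<mu> \<sigma> - \<mu> 0 \<ge> m - \<mu> 0"
  proof -
    have nz: "K z \<noteq> 0" if z: "Im z > 0" for z
    proof
      assume "K z = 0"
      from upper_zero_on_axis[OF K_nz z this] have ax: "Re z = 0" and nc: "\<And>w. \<exists>z. K z \<noteq> K w" .
      have "z = \<i> * of_real (Im z)" using ax by (simp add: complex_eq_iff)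
      hence "axis_value (Im z) = 0" using \<open>K z = 0\<close> by (metis axis_value_def zero_complex.sel(1))
      thus False
        using axis_value_strict_antimono[OF nc, of 0 "Im z"] h_gt[of "Im z", OF _ nc] z c h0 by simp
    qed
    obtain t :: real where t: "t \<in> {1, -1}" "\<And>y. y \<ge> 0 \<Longrightarrow> t * axis_value y \<ge> 0"
    proof (cases "\<mu> \<sigma> - \<mu> 0 \<le> 0")
      case True
      show ?thesis
        by (rule that[of "-1"]) (use True h0 axis_value_antimono[of 0] in force)+
    next
      case False
      show ?thesis
        by (rule that[of 1]) (use False c h_ge in force)+
    qed
    have bnd: "norm (F z) \<le> V \<sigma> - V 0" if "Im z \<ge> 0" for z
      unfolding F_eq by (rule fourier_stieltjes_norm_le[OF \<sigma> V that])
    have reals: "norm (F (of_real x)) \<le> norm (K (of_real x))" for x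
    proof -
      have "F (- of_real x) = cnj (F (of_real x))" using F_cnj[of "of_real x"] by simp
      thus ?thesis by (simp add: K_def norm_mult)
    qed
    have le: "norm (F z) \<le> exp (- \<sigma> * Im z) * norm (F (- z))" if "Im z \<ge> 0" for z
      using outer_majorant[OF t nz holF bnd reals that] by (simp add: K_def norm_mult)
    have conjF: "conj_fun F z = F (- z)" for z
      using F_cnj[of "cnj z"] by (simp add: conj_fun_def)
    have "F \<in> HB_bar"
      unfolding HB_bar_def
    proof (intro CollectI conjI allI impI holF)
      show "F z \<noteq> 0" if "Im z < 0" for z using nz[of "- z"] that by (simp add: K_zero)
      show "norm (F z / conj_fun F z) \<le> 1" if z: "Im z > 0" for z
      proof -
        have "norm (F z) \<le> 1 * norm (F (- z))"
          using z \<sigma> by (intro order_trans[OF le] mult_right_mono) auto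
        thus ?thesis using nz[OF z] by (simp add: conjF K_zero norm_divide divide_simps)
      qed
    qed
    moreover have "\<not> trivial_HB F"
    proof
      assume "trivial_HB F"
      from trivial_HB_norm_reflect[OF holF F_cnj this, of \<i>] le[of \<i>]
      have "norm (F (- \<i>)) \<le> exp (- \<sigma>) * norm (F (- \<i>))" by simp
      moreover have "norm (F (- \<i>)) > 0" using nz[of \<i>] by (simp add: K_zero)
      moreover have "exp (- \<sigma>) < 1" using \<sigma> by simp
      ultimately show False by (simp add: mult_le_cancel_right1)
    qed
    ultimately show ?thesis ..
  qed

  have case2: "\<exists>z0. {z. Im z < 0 \<and> F z = 0} = {z0} \<and> zorder F z0 = 1 \<and> Re z0 = 0"
    if c: "0 < \<mu> \<sigma> - \<mu> 0" "\<mu> \<sigma> - \<mu> 0 < m - \<mu> 0"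
  proof -
    have "\<forall>\<^sub>F y in at_top. axis_value y < 0" using order_tendstoD(2)[OF h_lim] c by simp
    then obtain Y where Y: "axis_value Y < 0" "Y \<ge> 0"
      using eventually_conj[OF _ eventually_ge_at_top[of 0], THEN eventually_happens] by auto
    obtain y where y: "0 \<le> y" "axis_value y = 0"
      using IVT2[of axis_value Y 0 0] Y c h0 DERIV_isCont[OF axis_value_deriv] by auto
    have y0: "y > 0" using y c h0 by (cases "y = 0") auto
    have Ky: "K (\<i> * of_real y) = 0" using y K_axis by simp
    have nc: "\<exists>z. K z \<noteq> K w" for w
      using upper_zero_on_axis(2)[OF K_nz _ Ky] y0 by simp
    have "{z. Im z < 0 \<and> F z = 0} = {- (\<i> * of_real y)}"
    proof (intro equalityI subsetI)
      fix z assume "z \<in> {z. Im z < 0 \<and> F z = 0}"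
      hence z: "Im (- z) > 0" "K (- z) = 0" by (auto simp: K_zero)
      have ax: "- z = \<i> * of_real (- Im z)"
        using upper_zero_on_axis(1)[OF K_nz z] by (simp add: complex_eq_iff)
      hence "axis_value (- Im z) = 0" using z(2) by (metis axis_value_def zero_complex.sel(1))
      hence "- Im z = y"
        using axis_value_strict_antimono[OF nc, of "- Im z" y] axis_value_strict_antimono[OF nc, of y "- Im z"]
          y z(1) by (cases "- Im z" y rule: linorder_cases) auto
      thus "z \<in> {- (\<i> * of_real y)}" using ax by (metis minus_minus singletonI)
    next
      fix z assume "z \<in> {- (\<i> * of_real y)}"
      thus "z \<in> {z. Im z < 0 \<and> F z = 0}" using y0 Ky by (auto simp: K_zero)
    qed
    moreover have "zorder F (- (\<i> * of_real y)) = 1"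
      using order_on_axis[OF nc y0] zorder_K[of "- (\<i> * of_real y)"] by (simp add: Ky)
    ultimately show ?thesis by (intro exI[of _ "- (\<i> * of_real y)"]) auto
  qed
  show ?thesis
    using real_zeros zero_order m case1 case2 unfolding F0 by (auto simp flip: of_real_diff)
qed

end
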